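(* Let $(P_n)_{n\in\mathbb{N}}$ be a sequence of nonconstant polynomials with complex coefficients, written as $P_n(z)=\sum_{j=m(n)}^{d(n)}c_{j,n}z^j$ with $m(n)\le d(n)$ and $c_{m(n),n}\neq 0\neq c_{d(n),n}$. Assume that: (a) the sequence $(m(n))_{n\in\mathbb{N}}$ of valences is unbounded; (b) at least one of the following three properties is satisfied: (P) there is an $\mathcal{E}$-unicity set $U\subset\mathbb{C}$ such that $\lim_{n\to\infty}|P_n(z)|=+\infty$ for all $z\in U$; (Q) for each $k\in\mathbb{N}$, $\lim_{n\to\infty}m(n)\,|c_{m(n),n}|^{k/m(n)}=+\infty$ and the sequence $\{c_{k+m(n),n}:n\in\mathbb{N}\}$ is bounded, where $c_{j,n}=0$ if $j>d(n)$ (here $m(n)\geq 1$ for all sufficiently large $n$, so that the expression in the limit is defined); (R) there is $r>0$ such that $\lim_{n\to\infty}\min\{|P_n(z)|:|z|=r\}=+\infty$. Then the set $HC((P_n(D)))$ is spaceable in $H(\mathbb{C})$.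
   Context: $\mathbb{N}=\{1,2,3,\dots\}$. $H(\mathbb{C})$ is the Fréchet space of all entire functions with the topology of uniform convergence on compact sets. For a polynomial $P(z)=\sum_{j}c_jz^j$, $P(D)$ is the continuous linear operator on $H(\mathbb{C})$ given by $P(D)f=\sum_j c_j f^{(j)}$. The valence of a nonconstant polynomial $P(z)=\sum_{j=m}^d c_jz^j$ with $c_m\ne0\ne c_d$ is $m\in\mathbb{N}\cup\{0\}$ (the multiplicity at the origin). For a sequence $T_n:X\to Y$ of continuous linear mappings between topological vector spaces, $x_0\in X$ is hypercyclic for $(T_n)$ if $\{T_n(x_0):n\in\mathbb{N}\}$ is dense in $Y$; $HC((T_n))$ is the set of all vectors hypercyclic for $(T_n)$. $\mathcal{E}$ is the class of entire functions of exponential type, i.e. entire $\Phi$ for which there are positive constants $A,B$ with $|\Phi(z)|\le Ae^{B|z|}$ for all $z\in\mathbb{C}$. A set $U\subset\mathbb{C}$ is an $\mathcal{E}$-unicity set if every $f\in\mathcal{E}$ with $f(z)=0$ for all $z\in U$ satisfies $f\equiv0$. A subset $A$ of a topological vector space $X$ is spaceable if there is a closed infinite-dimensional vector subspace $M\subset X$ with $M\subset A\cup\{0\}$. *)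

theory Defs
  imports "HOL-Complex_Analysis.Complex_Analysis" "HOL-Library.Function_Algebras"
begin

definition entire_functions :: "(complex \<Rightarrow> complex) set" where
  "entire_functions = {f. f holomorphic_on UNIV}"

text \<open>The topology of uniform convergence on compact sets: the sets
  \<open>{g. g entire, |g - f| < e on K}\<close> with \<open>K\<close> compact and \<open>e > 0\<close> form a
  neighbourhood base at the entire function \<open>f\<close>.\<close>

definition entire_topology :: "(complex \<Rightarrow> complex) topology" where
  "entire_topology = topology (\<lambda>S. S \<subseteq> entire_functions \<and>
     (\<forall>f\<in>S. \<exists>K e. compact K \<and> e > 0 \<and>
        {g \<in> entire_functions. \<forall>z\<in>K. dist (g z) (f z) < e} \<subseteq> S))"

lemma openin_entire_topology:
  "openin entire_topology S \<longleftrightarrow> S \<subseteq> entire_functions \<and>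
     (\<forall>f\<in>S. \<exists>K e. compact K \<and> e > 0 \<and>
        {g \<in> entire_functions. \<forall>z\<in>K. dist (g z) (f z) < e} \<subseteq> S)"
proof -
  have "istopology (\<lambda>S. S \<subseteq> entire_functions \<and>
     (\<forall>f\<in>S. \<exists>K e. compact K \<and> e > 0 \<and>
        {g \<in> entire_functions. \<forall>z\<in>K. dist (g z) (f z) < e} \<subseteq> S))"
    unfolding istopology_def
  proof (rule conjI; intro allI impI conjI ballI)
    fix S T f
    assume S: "S \<subseteq> entire_functions \<and> (\<forall>f\<in>S. \<exists>K e. compact K \<and> e > 0 \<and>
        {g \<in> entire_functions. \<forall>z\<in>K. dist (g z) (f z) < e} \<subseteq> S)"
      and T: "T \<subseteq> entire_functions \<and> (\<forall>f\<in>T. \<exists>K e. compact K \<and> e > 0 \<and>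
        {g \<in> entire_functions. \<forall>z\<in>K. dist (g z) (f z) < e} \<subseteq> T)"
    show "S \<inter> T \<subseteq> entire_functions" using S by blast
    assume f: "f \<in> S \<inter> T"
    obtain K e where K: "compact K" "e > 0"
      "{g \<in> entire_functions. \<forall>z\<in>K. dist (g z) (f z) < e} \<subseteq> S"
      using S f by (meson IntD1)
    obtain L d where L: "compact L" "d > 0"
      "{g \<in> entire_functions. \<forall>z\<in>L. dist (g z) (f z) < d} \<subseteq> T"
      using T f by (meson IntD2)
    have "{g \<in> entire_functions. \<forall>z\<in>K \<union> L. dist (g z) (f z) < min e d} \<subseteq> S \<inter> T"
      using K(3) L(3) by auto
    moreover have "compact (K \<union> L)" "min e d > 0" using K L by (auto intro: compact_Un)
    ultimately show "\<exists>K e. compact K \<and> e > 0 \<and>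
        {g \<in> entire_functions. \<forall>z\<in>K. dist (g z) (f z) < e} \<subseteq> S \<inter> T" by blast
  next
    fix \<K>
    assume *: "\<forall>S\<in>\<K>. S \<subseteq> entire_functions \<and> (\<forall>f\<in>S. \<exists>K e. compact K \<and> e > 0 \<and>
        {g \<in> entire_functions. \<forall>z\<in>K. dist (g z) (f z) < e} \<subseteq> S)"
    show "\<Union>\<K> \<subseteq> entire_functions" using * by blast
    fix f assume "f \<in> \<Union>\<K>"
    then obtain S where S: "S \<in> \<K>" "f \<in> S" by blast
    then obtain K e where "compact K" "e > 0"
      "{g \<in> entire_functions. \<forall>z\<in>K. dist (g z) (f z) < e} \<subseteq> S"
      using * by meson
    then show "\<exists>K e. compact K \<and> e > 0 \<and>
        {g \<in> entire_functions. \<forall>z\<in>K. dist (g z) (f z) < e} \<subseteq> \<Union>\<K>"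
      using S(1) by (meson Union_upper order_trans)
  qed
  then show ?thesis
    by (simp add: entire_topology_def)
qed

lemma topspace_entire_topology [simp]: "topspace entire_topology = entire_functions"
proof -
  have "openin entire_topology entire_functions"
    unfolding openin_entire_topology by (auto intro!: exI[of _ "{}"] exI[of _ "1::real"])
  then show ?thesis
    by (metis openin_entire_topology openin_subset openin_topspace subset_antisym)
qed

definition fun_scale :: "complex \<Rightarrow> (complex \<Rightarrow> complex) \<Rightarrow> complex \<Rightarrow> complex" where
  "fun_scale c f = (\<lambda>z. c * f z)"

lemma vector_space_fun_scale: "vector_space fun_scale"
  by unfold_locales (auto simp: fun_scale_def algebra_simps)

definition poly_D :: "complex poly \<Rightarrow> (complex \<Rightarrow> complex) \<Rightarrow> complex \<Rightarrow> complex" where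
  "poly_D p f = (\<lambda>z. \<Sum>j\<le>degree p. coeff p j * (deriv ^^ j) f z)"

definition valence :: "complex poly \<Rightarrow> nat" where
  "valence p = (LEAST j. coeff p j \<noteq> 0)"

text \<open>Sequences are indexed by the positive integers; the value at index 0 is ignored.\<close>

definition hypercyclic_vectors ::
    "'a topology \<Rightarrow> 'b topology \<Rightarrow> (nat \<Rightarrow> 'a \<Rightarrow> 'b) \<Rightarrow> 'a set" where
  "hypercyclic_vectors X Y T =
     {x \<in> topspace X. Y closure_of ((\<lambda>n. T n x) ` {1..}) = topspace Y}"

text \<open>Here \<open>smul\<close> is the scalar multiplication of a vector space structure on the type
  \<open>'a\<close>, of which the points of the topological vector space \<open>X\<close> form a linear subspace.\<close>

definition spaceable ::
    "('k::field \<Rightarrow> 'a \<Rightarrow> 'a) \<Rightarrow> 'a::ab_group_add topology \<Rightarrow> 'a set \<Rightarrow> bool" where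
  "spaceable smul X A \<longleftrightarrow>
     (\<exists>M. closedin X M \<and> module.subspace smul M \<and>
          (\<nexists>B. finite B \<and> module.span smul B = M) \<and>
          M \<subseteq> A \<union> {0})"

definition exponential_type :: "(complex \<Rightarrow> complex) set" where
  "exponential_type = {\<Phi>. \<Phi> holomorphic_on UNIV \<and>
     (\<exists>A>0. \<exists>B>0. \<forall>z. cmod (\<Phi> z) \<le> A * exp (B * cmod z))}"

definition unicity_set :: "complex set \<Rightarrow> bool" where
  "unicity_set U \<longleftrightarrow> (\<forall>f\<in>exponential_type. (\<forall>z\<in>U. f z = 0) \<longrightarrow> (\<forall>z. f z = 0))"

definition property_P :: "(nat \<Rightarrow> complex poly) \<Rightarrow> bool" where
  "property_P P \<longleftrightarrow>
     (\<exists>U. unicity_set U \<and> (\<forall>z\<in>U. filterlim (\<lambda>n. cmod (poly (P n) z)) at_top sequentially))"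

definition property_Q :: "(nat \<Rightarrow> complex poly) \<Rightarrow> bool" where
  "property_Q P \<longleftrightarrow>
     (\<forall>\<^sub>F n in sequentially. valence (P n) \<ge> 1) \<and>
     (\<forall>k\<ge>1.
        filterlim (\<lambda>n. real (valence (P n)) *
            cmod (coeff (P n) (valence (P n))) powr (real k / real (valence (P n))))
          at_top sequentially \<and>
        bounded ((\<lambda>n. coeff (P n) (k + valence (P n))) ` {1..}))"

text \<open>The infimum over the compact circle is attained, so it is the minimum.\<close>

definition property_R :: "(nat \<Rightarrow> complex poly) \<Rightarrow> bool" where
  "property_R P \<longleftrightarrow>
     (\<exists>r>0. filterlim (\<lambda>n. INF z\<in>sphere 0 r. cmod (poly (P n) z)) at_top sequentially)"

end

theory Submission imports Defs begin

text \<open>Since \<open>P n (D)\<close> kills all polynomials of degree below the valence, the problem splits into two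
  parts. First, along indices with large valence every entire function is approximately
  \<open>P n (D) h\<close> with \<open>h\<close> small. Under (P), and hence (R), the exponentials
  \<open>exp (w * z)\<close>, \<open>w \<in> U\<close>, have the preimages \<open>exp (w * z) / P n w\<close>, and they span a dense
  subspace by duality; under (Q) one inverts \<open>P n (D)\<close> on monomials. Truncating, \<open>h\<close> becomes a
  polynomial without terms below the valence.

  Second, one chooses such polynomials \<open>p t\<close> supported in disjoint blocks of exponents separated by
  the positions \<open>a t\<close>, where \<open>a (Suc t)\<close> dominates the size of the \<open>t\<close>-th operator. The subspace
  consists of the entire functions whose coefficients in block \<open>t\<close> are those of \<open>p t\<close> times the
  (free) coefficient at position \<open>a (Suc (i t))\<close>. It is closed because it is cut out by linear
  relations between Taylor coefficients, and on a member \<open>f\<close> the \<open>t\<close>-th operator returns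
  approximately that free coefficient times the \<open>t\<close>-th target.\<close>

section \<open>Closure properties of entire functions\<close>

lemma entireI: "f holomorphic_on UNIV \<Longrightarrow> f \<in> entire_functions"
  by (simp add: entire_functions_def)

lemma entireD: "f \<in> entire_functions \<Longrightarrow> f holomorphic_on A"
  using holomorphic_on_subset by (auto simp: entire_functions_def)

lemma entire_add: "f \<in> entire_functions \<Longrightarrow> g \<in> entire_functions \<Longrightarrow> (\<lambda>z. f z + g z) \<in> entire_functions"
  by (auto simp: entire_functions_def intro: holomorphic_intros)

lemma entire_diff: "f \<in> entire_functions \<Longrightarrow> g \<in> entire_functions \<Longrightarrow> (\<lambda>z. f z - g z) \<in> entire_functions"
  by (auto simp: entire_functions_def intro: holomorphic_intros)

lemma entire_cmult: "f \<in> entire_functions \<Longrightarrow> (\<lambda>z. c * f z) \<in> entire_functions"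
  by (auto simp: entire_functions_def intro: holomorphic_intros)

lemma entire_sum:
  "(\<And>i. i \<in> I \<Longrightarrow> f i \<in> entire_functions) \<Longrightarrow> (\<lambda>z. \<Sum>i\<in>I. f i z) \<in> entire_functions"
  by (auto simp: entire_functions_def intro: holomorphic_intros)

lemma entire_poly: "poly p \<in> entire_functions"
  by (auto simp: entire_functions_def intro: holomorphic_intros)

lemma entire_bounded_cball:
  assumes "f \<in> entire_functions"
  obtains B where "B > 0" "\<And>z. z \<in> cball 0 R \<Longrightarrow> cmod (f z) \<le> B"
proof -
  have "bounded (f ` cball 0 R)"
    using assms by (intro compact_imp_bounded compact_continuous_image holomorphic_on_imp_continuous_on)
      (auto intro: entireD)
  then show ?thesis
    using that by (auto simp: bounded_pos)
qed

subsection \<open>Taylor coefficients at the origin\<close>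

definition taylor_coeff :: "(complex \<Rightarrow> complex) \<Rightarrow> nat \<Rightarrow> complex" where
  "taylor_coeff f j = (deriv ^^ j) f 0 / fact j"

lemma taylor_coeff_add:
  "f \<in> entire_functions \<Longrightarrow> g \<in> entire_functions \<Longrightarrow>
    taylor_coeff (\<lambda>z. f z + g z) j = taylor_coeff f j + taylor_coeff g j"
  by (simp add: taylor_coeff_def entireD add_divide_distrib higher_deriv_add[of _ UNIV])

lemma taylor_coeff_diff:
  "f \<in> entire_functions \<Longrightarrow> g \<in> entire_functions \<Longrightarrow>
    taylor_coeff (\<lambda>z. f z - g z) j = taylor_coeff f j - taylor_coeff g j"
  by (simp add: taylor_coeff_def entireD diff_divide_distrib higher_deriv_diff[of _ UNIV])

lemma taylor_coeff_cmult:
  "f \<in> entire_functions \<Longrightarrow> taylor_coeff (\<lambda>z. c * f z) j = c * taylor_coeff f j"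
  by (simp add: taylor_coeff_def entireD higher_deriv_cmult[of _ UNIV])

lemma taylor_sums:
  assumes "f \<in> entire_functions"
  shows "(\<lambda>j. taylor_coeff f j * z ^ j) sums f z"
proof -
  have "f holomorphic_on ball 0 (norm z + 1)" "z \<in> ball 0 (norm z + 1)"
    using assms by (auto intro: entireD)
  from holomorphic_power_series[OF this] show ?thesis by (simp add: taylor_coeff_def)
qed

text \<open>A series that converges at every point has infinite radius of convergence, so it may be
  differentiated termwise. This is the tool for building entire functions from prescribed
  coefficients.\<close>

lemma taylor_coeff_eqI:
  assumes "\<And>z. (\<lambda>j. b j * z ^ j) sums f z"
  shows "f \<in> entire_functions" "taylor_coeff f j = b j"
proof -
  have f: "f = eval_fps (Abs_fps b)"
    using assms by (auto simp: eval_fps_def fun_eq_iff sums_iff)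
  have "conv_radius b = \<infinity>"
    using assms by (intro conv_radius_inftyI'') (auto dest: sums_summable)
  then have r: "fps_conv_radius (Abs_fps b) = \<infinity>"
    by (simp add: fps_conv_radius_def)
  show "f \<in> entire_functions"
    unfolding f by (intro entireI holomorphic_intros) (auto simp: r eball_def)
  show "taylor_coeff f j = b j"
    using fps_nth_conv_deriv[of "Abs_fps b" j] by (simp add: r taylor_coeff_def f)
qed

lemma taylor_coeff_poly: "taylor_coeff (poly p) j = coeff p j"
proof (rule taylor_coeff_eqI(2))
  show "(\<lambda>j. coeff p j * z ^ j) sums poly p z" for z
    unfolding poly_altdef by (rule sums_finite) (auto simp: coeff_eq_0)
qed

lemma entire_eqI:
  assumes "f \<in> entire_functions" "g \<in> entire_functions" "\<And>j. taylor_coeff f j = taylor_coeff g j"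
  shows "f = g"
proof
  fix z show "f z = g z"
    using taylor_sums[OF assms(1), of z] taylor_sums[OF assms(2), of z] assms(3)
    by (simp add: sums_unique2)
qed

lemma norm_taylor_coeff_le:
  assumes "f \<in> entire_functions" "r > 0" "\<And>z. z \<in> cball 0 r \<Longrightarrow> cmod (f z) \<le> B"
  shows "cmod (taylor_coeff f j) * r ^ j \<le> B"
proof -
  have "cmod ((deriv ^^ j) f 0) \<le> fact j * B / r ^ j"
    using assms by (intro Cauchy_inequality holomorphic_on_imp_continuous_on) (auto intro: entireD)
  then show ?thesis
    using \<open>r > 0\<close> by (simp add: taylor_coeff_def norm_divide field_simps)
qed

text \<open>Converse of the Cauchy estimate: the extra decay \<open>1 / 2 ^ j\<close> makes the
  Taylor series geometric, and starting it at \<open>J\<close> gains the factor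
  \<open>1 / 2 ^ J\<close>. That decay typically comes from a Cauchy estimate on a disc of larger
  radius.\<close>

lemma norm_entire_le_geometric:
  assumes f: "f \<in> entire_functions" and "r \<ge> 0"
    and low: "\<And>j. j < J \<Longrightarrow> taylor_coeff f j = 0"
    and high: "\<And>j. j \<ge> J \<Longrightarrow> cmod (taylor_coeff f j) * r ^ j \<le> C / 2 ^ j"
    and z: "z \<in> cball 0 r"
  shows "cmod (f z) \<le> 2 * C / 2 ^ J"
proof -
  have "(\<lambda>j. taylor_coeff f (j + J) * z ^ (j + J)) sums f z"
    using sums_iff_shift[of "\<lambda>j. taylor_coeff f j * z ^ j" J "f z"] taylor_sums[OF f, of z] low by simp
  moreover have "cmod (taylor_coeff f (j + J) * z ^ (j + J)) \<le> C / 2 ^ J * (1/2) ^ j" for j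
  proof -
    have "cmod z ^ (j + J) \<le> r ^ (j + J)"
      using z by (intro power_mono) auto
    then have "cmod (taylor_coeff f (j + J) * z ^ (j + J)) \<le> cmod (taylor_coeff f (j + J)) * r ^ (j + J)"
      by (simp add: norm_mult norm_power mult_left_mono)
    also have "\<dots> \<le> C / 2 ^ (j + J)" by (intro high) simp
    also have "\<dots> = C / 2 ^ J * (1/2) ^ j" by (simp add: power_add field_simps)
    finally show ?thesis .
  qed
  moreover have "(\<lambda>j. C / 2 ^ J * (1/2) ^ j) sums (C / 2 ^ J * 2)"
    using sums_mult[OF geometric_sums[of "1/2::real"], of "C / 2 ^ J"] by simp
  ultimately show ?thesis
    using norm_suminf_le[of "\<lambda>j. taylor_coeff f (j + J) * z ^ (j + J)" "\<lambda>j. C / 2 ^ J * (1/2) ^ j"]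
    by (simp add: sums_iff mult.commute)
qed

definition poly_of_coeffs :: "(nat \<Rightarrow> complex) \<Rightarrow> nat \<Rightarrow> complex poly" where
  "poly_of_coeffs b J = (\<Sum>j<J. monom (b j) j)"

lemma coeff_poly_of_coeffs: "coeff (poly_of_coeffs b J) j = (if j < J then b j else 0)"
  by (simp add: poly_of_coeffs_def coeff_sum if_distrib[of "\<lambda>x. coeff x j"] coeff_monom
      if_distrib sum.delta' cong: if_cong)

text \<open>Cauchy estimates on the disc of radius \<open>2 * r\<close> bound the remainder on the
  disc of radius \<open>r\<close> by \<open>2 * B / 2 ^ J\<close>.\<close>

lemma taylor_polynomial_uniform:
  assumes f: "f \<in> entire_functions" and "\<epsilon> > 0"
  obtains J where "J > N" "\<And>z. z \<in> cball 0 R \<Longrightarrow>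
    cmod (f z - poly (poly_of_coeffs (taylor_coeff f) J) z) \<le> \<epsilon>"
proof -
  define r where "r = max R 1"
  have r: "r > 0" "r \<ge> R" by (auto simp: r_def)
  obtain B where B: "B > 0" "\<And>z. z \<in> cball 0 (2 * r) \<Longrightarrow> cmod (f z) \<le> B"
    using entire_bounded_cball[OF f] by metis
  have "(\<lambda>J. 2 * B * (1/2) ^ J) \<longlonglongrightarrow> 2 * B * 0"
    by (intro tendsto_intros LIMSEQ_power_zero) auto
  then have "\<forall>\<^sub>F J in sequentially. 2 * B * (1/2) ^ J < \<epsilon>"
    using \<open>\<epsilon> > 0\<close> by (auto dest: order_tendstoD)
  then obtain J where J: "J > N" "2 * B * (1/2) ^ J < \<epsilon>"
    using eventually_happens[OF eventually_conj[OF _ eventually_gt_at_top[of N]]] by auto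
  let ?g = "\<lambda>z. f z - poly (poly_of_coeffs (taylor_coeff f) J) z"
  have c: "taylor_coeff ?g j = (if j < J then 0 else taylor_coeff f j)" for j
    using f by (simp add: taylor_coeff_diff entire_poly taylor_coeff_poly coeff_poly_of_coeffs)
  have "cmod (?g z) \<le> \<epsilon>" if "z \<in> cball 0 R" for z
  proof -
    have "cmod (?g z) \<le> 2 * B / 2 ^ J"
    proof (rule norm_entire_le_geometric[where f = ?g and r = r])
      show "?g \<in> entire_functions" using f by (intro entire_diff entire_poly)
      show "z \<in> cball 0 r" using that r by auto
      show "cmod (taylor_coeff ?g j) * r ^ j \<le> B / 2 ^ j" if "j \<ge> J" for j
        using norm_taylor_coeff_le[OF f _ B(2), of "2 * r" j] r that
        by (simp add: c power_mult_distrib field_simps)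
    qed (use r c in auto)
    moreover have "2 * B / 2 ^ J \<le> \<epsilon>" using J by (simp add: power_one_over field_simps)
    ultimately show ?thesis by simp
  qed
  with J show ?thesis using that by blast
qed

subsection \<open>Polynomial differential operators\<close>

lemma entire_higher_deriv: "f \<in> entire_functions \<Longrightarrow> (deriv ^^ j) f \<in> entire_functions"
  by (auto simp: entire_functions_def intro: holomorphic_higher_deriv)

lemma entire_poly_D: "f \<in> entire_functions \<Longrightarrow> poly_D p f \<in> entire_functions"
  unfolding poly_D_def by (intro entire_sum entire_cmult entire_higher_deriv)

lemma poly_D_add:
  "f \<in> entire_functions \<Longrightarrow> g \<in> entire_functions \<Longrightarrow>
    poly_D p (\<lambda>z. f z + g z) = (\<lambda>z. poly_D p f z + poly_D p g z)"
  by (simp add: poly_D_def entireD higher_deriv_add[of _ UNIV] algebra_simps sum.distrib)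

lemma poly_D_diff:
  "f \<in> entire_functions \<Longrightarrow> g \<in> entire_functions \<Longrightarrow>
    poly_D p (\<lambda>z. f z - g z) = (\<lambda>z. poly_D p f z - poly_D p g z)"
  by (simp add: poly_D_def entireD higher_deriv_diff[of _ UNIV] algebra_simps sum_subtractf)

lemma poly_D_cmult:
  "f \<in> entire_functions \<Longrightarrow> poly_D p (\<lambda>z. c * f z) = (\<lambda>z. c * poly_D p f z)"
  by (simp add: poly_D_def entireD higher_deriv_cmult[of _ UNIV] algebra_simps sum_distrib_left)

lemma poly_D_zero: "poly_D p (\<lambda>z. 0) = (\<lambda>z. 0)"
  using poly_D_cmult[of "poly 0" p 0] entire_poly[of 0] by simp

lemma poly_D_sum:
  assumes "finite I" "\<And>i. i \<in> I \<Longrightarrow> f i \<in> entire_functions"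
  shows "poly_D p (\<lambda>z. \<Sum>i\<in>I. f i z) = (\<lambda>z. \<Sum>i\<in>I. poly_D p (f i) z)"
  using assms
proof (induction I rule: finite_induct)
  case empty
  then show ?case by (simp add: poly_D_zero)
next
  case (insert x I)
  then show ?case by (simp add: poly_D_add entire_sum)
qed

lemma poly_D_exp: "poly_D p (\<lambda>z. exp (w * z)) = (\<lambda>z. poly p w * exp (w * z))"
proof -
  have "(deriv ^^ j) (\<lambda>z. exp (w * z)) = (\<lambda>z. w ^ j * exp (w * z))" for j
  proof (induction j)
    case (Suc j)
    have "deriv (\<lambda>z. w ^ j * exp (w * z)) z = w * w ^ j * exp (w * z)" for z
      by (rule DERIV_imp_deriv) (auto intro!: derivative_eq_intros)
    with Suc show ?case by auto
  qed simp
  then show ?thesis by (simp add: poly_D_def poly_altdef sum_distrib_right mult.assoc)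
qed

lemma higher_deriv_poly_D:
  assumes "f \<in> entire_functions"
  shows "(deriv ^^ i) (poly_D p f) z = (\<Sum>j\<le>degree p. coeff p j * (deriv ^^ (i + j)) f z)"
proof -
  have sum: "(deriv ^^ i) (\<lambda>z. \<Sum>j\<in>I. g j z) z = (\<Sum>j\<in>I. (deriv ^^ i) (g j) z)"
    if "finite I" "\<And>j. j \<in> I \<Longrightarrow> g j \<in> entire_functions" for I and g :: "nat \<Rightarrow> complex \<Rightarrow> complex"
    using that
  proof (induction I rule: finite_induct)
    case (insert x I)
    then show ?case by (simp add: higher_deriv_add[of _ UNIV] entire_sum entireD)
  qed simp
  show ?thesis
    unfolding poly_D_def
    using assms by (subst sum) (simp_all add: entire_higher_deriv entire_cmult
        higher_deriv_cmult[of _ UNIV] entireD funpow_add)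
qed

text \<open>Every derivative occurring in \<open>p\<close> has order at least \<open>m\<close> and
  annihilates polynomials of degree below \<open>m\<close>. With \<open>m\<close> the valence, this
  makes low order Taylor terms invisible to the operator.\<close>

lemma poly_D_eq_0:
  assumes f: "f \<in> entire_functions" and "\<And>j. j < m \<Longrightarrow> coeff p j = 0"
    and "\<And>j. j \<ge> m \<Longrightarrow> taylor_coeff f j = 0"
  shows "poly_D p f = (\<lambda>z. 0)"
proof (rule entire_eqI)
  show "(\<lambda>z::complex. 0::complex) \<in> entire_functions" by (auto intro: entireI)
  have "taylor_coeff (poly_D p f) i = 0" for i
  proof -
    have "coeff p j * (deriv ^^ (i + j)) f 0 = 0" for j
      using assms(2)[of j] assms(3)[of "i + j"] by (cases "j < m") (auto simp: taylor_coeff_def)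
    then have "(deriv ^^ i) (poly_D p f) 0 = 0"
      unfolding higher_deriv_poly_D[OF f] by (intro sum.neutral) blast
    then show ?thesis by (simp add: taylor_coeff_def)
  qed
  moreover have "taylor_coeff (\<lambda>z. 0) i = 0" for i
    by (simp add: taylor_coeff_def)
  ultimately show "taylor_coeff (poly_D p f) i = taylor_coeff (\<lambda>z. 0) i" for i by simp
qed (use f in \<open>rule entire_poly_D\<close>)

text \<open>Bound for the operator from the sup norm on radius \<open>R + 1\<close> to that on
  radius \<open>R\<close>, obtained from Cauchy estimates on circles of radius 1.\<close>

definition poly_D_bound :: "complex poly \<Rightarrow> real" where
  "poly_D_bound p = (\<Sum>j\<le>degree p. cmod (coeff p j) * fact j)"

lemma norm_poly_D_le:
  assumes f: "f \<in> entire_functions" and B: "\<And>z. z \<in> cball 0 (R + 1) \<Longrightarrow> cmod (f z) \<le> B"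
    and z: "z \<in> cball 0 R"
  shows "cmod (poly_D p f z) \<le> poly_D_bound p * B"
proof -
  have "cmod ((deriv ^^ j) f z) \<le> fact j * B" for j
  proof -
    have "cmod (f x) \<le> B" if "norm (z - x) = 1" for x
      using z that norm_triangle_ineq2[of x z] by (intro B) (auto simp: norm_minus_commute)
    then have "cmod ((deriv ^^ j) f z) \<le> fact j * B / 1 ^ j"
      using f by (intro Cauchy_inequality holomorphic_on_imp_continuous_on) (auto intro: entireD)
    then show ?thesis by simp
  qed
  then have "cmod (poly_D p f z) \<le> (\<Sum>j\<le>degree p. cmod (coeff p j) * (fact j * B))"
    unfolding poly_D_def by (intro sum_norm_le) (simp add: norm_mult mult_left_mono)
  then show ?thesis by (simp add: poly_D_bound_def sum_distrib_right mult.assoc)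
qed

subsection \<open>Density in weighted coefficient spaces\<close>

text \<open>The real l2 inner product; for complex entries each term is the real part of the
  Hermitian product. It is meaningful only for summable terms, for instance when one argument is
  absolutely summable and the other bounded.\<close>

definition seq_inner :: "(nat \<Rightarrow> 'a::real_inner) \<Rightarrow> (nat \<Rightarrow> 'a) \<Rightarrow> real" where
  "seq_inner x y = (\<Sum>j. x j \<bullet> y j)"

lemma summable_inner_bounded:
  fixes x y :: "nat \<Rightarrow> 'a::real_inner"
  assumes "summable (\<lambda>j. norm (x j))" "\<And>j. norm (y j) \<le> B"
  shows "summable (\<lambda>j. x j \<bullet> y j)"
proof (rule summable_comparison_test')
  show "summable (\<lambda>j. norm (x j) * B)" using assms(1) by (rule summable_mult2)
  show "norm (x j \<bullet> y j) \<le> norm (x j) * B" for j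
    using Cauchy_Schwarz_ineq2[of "x j" "y j"] mult_left_mono[OF assms(2)[of j], of "norm (x j)"]
    by simp
qed

lemma abs_summable_bounded:
  fixes x :: "nat \<Rightarrow> 'a::real_normed_vector"
  assumes "summable (\<lambda>j. norm (x j))"
  shows "norm (x j) \<le> (\<Sum>j. norm (x j))"
  using sum_le_suminf[OF assms, of "{j}"] by auto

lemma abs_summable_lin:
  fixes x y :: "nat \<Rightarrow> 'a::real_normed_vector"
  assumes "summable (\<lambda>j. norm (x j))" "summable (\<lambda>j. norm (y j))"
  shows "summable (\<lambda>j. norm (x j + t *\<^sub>R y j))"
proof (rule summable_comparison_test')
  show "summable (\<lambda>j. norm (x j) + \<bar>t\<bar> * norm (y j))"
    using assms by (intro summable_add summable_mult)
  show "norm (norm (x j + t *\<^sub>R y j)) \<le> norm (x j) + \<bar>t\<bar> * norm (y j)" for j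
    using norm_triangle_ineq[of "x j" "t *\<^sub>R y j"] by simp
qed

lemma summable_inner:
  fixes x y :: "nat \<Rightarrow> 'a::real_inner"
  assumes "summable (\<lambda>j. norm (x j))" "summable (\<lambda>j. norm (y j))"
  shows "summable (\<lambda>j. x j \<bullet> y j)"
  using assms(1) abs_summable_bounded[OF assms(2)] by (rule summable_inner_bounded)

lemma seq_inner_commute: "seq_inner x y = seq_inner y x"
  by (simp add: seq_inner_def inner_commute)

lemma seq_inner_lin_left:
  assumes "summable (\<lambda>j. norm (x j))" "summable (\<lambda>j. norm (y j))" "summable (\<lambda>j. norm (z j))"
  shows "seq_inner (\<lambda>j. x j + t *\<^sub>R y j) z = seq_inner x z + t * seq_inner y z"
  using summable_inner[OF assms(1,3)] summable_inner[OF assms(2,3)]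
  by (simp add: seq_inner_def inner_add_left suminf_add[symmetric] suminf_mult summable_mult)

lemma norm_le_seq_inner:
  assumes "summable (\<lambda>j. norm (x j))"
  shows "(norm (x j))\<^sup>2 \<le> seq_inner x x"
  using sum_le_suminf[OF summable_inner[OF assms assms], of "{j}"]
  by (simp add: seq_inner_def power2_norm_eq_inner)

lemma seq_inner_nonneg:
  assumes "summable (\<lambda>j. norm (x j))"
  shows "seq_inner x x \<ge> 0"
  unfolding seq_inner_def by (intro suminf_nonneg summable_inner assms) simp

lemma seq_inner_square:
  fixes x y :: "nat \<Rightarrow> 'a::real_inner"
  assumes x: "summable (\<lambda>j. norm (x j))" and y: "summable (\<lambda>j. norm (y j))"
  shows "seq_inner (\<lambda>j. x j + t *\<^sub>R y j) (\<lambda>j. x j + t *\<^sub>R y j) =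
    seq_inner x x + 2 * t * seq_inner x y + t\<^sup>2 * seq_inner y y"
proof -
  let ?s = "\<lambda>j. x j + t *\<^sub>R y j"
  have "seq_inner ?s ?s = seq_inner x ?s + t * seq_inner y ?s"
    by (rule seq_inner_lin_left[OF x y abs_summable_lin[OF x y]])
  also have "seq_inner x ?s = seq_inner x x + t * seq_inner x y"
    using seq_inner_lin_left[OF x y x, where t = t] seq_inner_commute[of x] by metis
  also have "seq_inner y ?s = seq_inner x y + t * seq_inner y y"
    using seq_inner_lin_left[OF x y y, where t = t] seq_inner_commute[of y ?s] by simp
  finally show ?thesis by (simp add: algebra_simps power2_eq_square)
qed

text \<open>Orthogonal projection without completeness of the sequence space: the residuals of a
  minimizing sequence converge coordinatewise, and the limit is orthogonal to \<open>V\<close>.\<close>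

lemma dense_if_orthogonal_trivial:
  fixes V :: "(nat \<Rightarrow> 'a::{real_inner, banach}) set"
  assumes V: "\<And>v. v \<in> V \<Longrightarrow> summable (\<lambda>j. norm (v j))"
    and V0: "(\<lambda>j. 0) \<in> V"
    and Vlin: "\<And>v w t. v \<in> V \<Longrightarrow> w \<in> V \<Longrightarrow> (\<lambda>j. v j + t *\<^sub>R w j) \<in> V"
    and q: "summable (\<lambda>j. norm (q j))"
    and orth: "\<And>y B j. (\<And>j. norm (y j) \<le> B) \<Longrightarrow> (\<And>v. v \<in> V \<Longrightarrow> (\<Sum>j. v j \<bullet> y j) = 0) \<Longrightarrow> y j = 0"
    and "\<epsilon> > 0"
  obtains v where "v \<in> V" "\<And>j. norm (q j - v j) \<le> \<epsilon>"
proof -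
  \<comment> \<open>Squared distance from \<open>q\<close>, written with the factor
    \<open>-1\<close> so that the rules for \<open>x + t y\<close> apply. Below,
    \<open>\<eta> n\<close> is the slack granted to the n-th minimiser.\<close>
  define dist2 where "dist2 v = seq_inner (\<lambda>j. q j + (-1) *\<^sub>R v j) (\<lambda>j. q j + (-1) *\<^sub>R v j)" for v
  define D where "D = (INF v\<in>V. dist2 v)"
  define \<eta> where "\<eta> n = inverse (real (Suc n))" for n
  have \<eta>: "\<eta> n > 0" "\<eta> n \<le> 1" for n by (auto simp: \<eta>_def divide_simps)
  have \<eta>0: "\<eta> \<longlonglongrightarrow> 0" unfolding \<eta>_def by (rule LIMSEQ_inverse_real_of_nat)
  have dist2_nonneg: "dist2 v \<ge> 0" if "v \<in> V" for v
    unfolding dist2_def by (intro seq_inner_nonneg abs_summable_lin q V that)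
  have bdd: "bdd_below (dist2 ` V)" using dist2_nonneg by (intro bdd_belowI[of _ 0]) auto
  have D_le: "D \<le> dist2 v" if "v \<in> V" for v
    unfolding D_def by (rule cINF_lower[OF bdd that])
  have "D \<ge> 0" unfolding D_def using V0 dist2_nonneg by (intro cINF_greatest) auto
  have "\<exists>v\<in>V. dist2 v < D + \<eta> n" for n
    using cINF_less_iff[OF _ bdd, of "D + \<eta> n"] V0 \<eta>(1)[of n] by (auto simp: D_def)
  then obtain v where v: "v n \<in> V" "dist2 (v n) < D + \<eta> n" for n by metis
  define x where "x n = (\<lambda>j. q j + (-1) *\<^sub>R v n j)" for n
  have x: "summable (\<lambda>j. norm (x n j))" for n
    unfolding x_def by (rule abs_summable_lin[OF q V[OF v(1)]])
  have Qx: "seq_inner (x n) (x n) < D + \<eta> n" "D \<le> seq_inner (x n) (x n)" for n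
    using v(2)[of n] D_le[OF v(1)[of n]] by (auto simp: dist2_def x_def)
  have D_le_shift: "D \<le> seq_inner (\<lambda>j. x n j + t *\<^sub>R w j) (\<lambda>j. x n j + t *\<^sub>R w j)"
    if "w \<in> V" for n t w
  proof -
    have "D \<le> dist2 (\<lambda>j. v n j + (- t) *\<^sub>R w j)"
      by (intro D_le Vlin v that)
    also have "(\<lambda>j. q j + (-1) *\<^sub>R (v n j + (- t) *\<^sub>R w j)) = (\<lambda>j. x n j + t *\<^sub>R w j)"
      by (simp add: x_def algebra_simps)
    then have "dist2 (\<lambda>j. v n j + (- t) *\<^sub>R w j) =
        seq_inner (\<lambda>j. x n j + t *\<^sub>R w j) (\<lambda>j. x n j + t *\<^sub>R w j)"
      by (simp add: dist2_def)
    finally show ?thesis .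
  qed
  \<comment> \<open>A quadratic in \<open>t\<close> that stays nonnegative has nonpositive
    discriminant. Its constant term is at most \<open>\<eta> n\<close> because \<open>x n\<close> is
    within \<open>\<eta> n\<close> of the minimum \<open>D\<close>.\<close>
  have almost_orth: "(seq_inner (x n) w)\<^sup>2 \<le> seq_inner w w * \<eta> n" if "w \<in> V" for n w
  proof -
    define b c where "b = seq_inner (x n) w" and "c = seq_inner w w"
    have pos: "0 \<le> \<eta> n + 2 * t * b + t\<^sup>2 * c" for t
      using D_le_shift[OF that, of n t] Qx(1)[of n] seq_inner_square[OF x V[OF that], where t = t]
      by (simp add: b_def c_def)
    have "c \<ge> 0" using seq_inner_nonneg[OF V[OF that]] by (simp add: c_def)
    have "b\<^sup>2 \<le> c * \<eta> n"
    proof (cases "c = 0")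
      case True
      have "b = 0"
      proof (rule ccontr)
        assume "b \<noteq> 0"
        then show False using pos[of "- \<eta> n / b"] True \<eta>(1)[of n] by simp
      qed
      then show ?thesis using True by simp
    next
      case False
      then show ?thesis
        using pos[of "- b / c"] \<open>c \<ge> 0\<close> by (simp add: field_simps power2_eq_square)
    qed
    then show ?thesis by (simp add: b_def c_def)
  qed
  \<comment> \<open>Parallelogram law: half of \<open>x n + x m\<close> is the residual of the
    midpoint of \<open>v n\<close> and \<open>v m\<close>, which lies in \<open>V\<close>, so its
    square is at least \<open>D\<close>.\<close>
  have Cauchy_bound: "(norm (x n j - x m j))\<^sup>2 \<le> 2 * \<eta> n + 2 * \<eta> m" for n m j
  proof -
    have par: "seq_inner (\<lambda>j. x n j + (-1) *\<^sub>R x m j) (\<lambda>j. x n j + (-1) *\<^sub>R x m j) +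
        seq_inner (\<lambda>j. x n j + 1 *\<^sub>R x m j) (\<lambda>j. x n j + 1 *\<^sub>R x m j) =
        2 * seq_inner (x n) (x n) + 2 * seq_inner (x m) (x m)"
      unfolding seq_inner_square[OF x x] by simp
    have half: "a + (1/2) *\<^sub>R (b - a) = (1/2) *\<^sub>R (a + 1 *\<^sub>R b)" for a b :: 'a
    proof -
      have "a + (1/2) *\<^sub>R (b - a) = ((1/2) *\<^sub>R a + (1/2) *\<^sub>R a) + (1/2) *\<^sub>R (b - a)"
        by (simp flip: scaleR_add_left)
      then show ?thesis by (simp add: scaleR_diff_right scaleR_add_right)
    qed
    have mid: "x n j + (1/2) *\<^sub>R (v n j + (-1) *\<^sub>R v m j) = (1/2) *\<^sub>R (x n j + 1 *\<^sub>R x m j)" for j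
      using half[of "x n j" "x m j"] by (simp add: x_def)
    have "D \<le> seq_inner (\<lambda>j. (1/2) *\<^sub>R (x n j + 1 *\<^sub>R x m j)) (\<lambda>j. (1/2) *\<^sub>R (x n j + 1 *\<^sub>R x m j))"
      using D_le_shift[OF Vlin[OF v(1)[of n] v(1)[of m], of "-1"], of n "1/2"] by (simp only: mid)
    also have "\<dots> = (1/4) * seq_inner (\<lambda>j. x n j + 1 *\<^sub>R x m j) (\<lambda>j. x n j + 1 *\<^sub>R x m j)"
      using seq_inner_square[of "\<lambda>j. 0" "\<lambda>j. x n j + 1 *\<^sub>R x m j" "1/2"] abs_summable_lin[OF x[of n] x[of m], of 1]
      by (simp add: seq_inner_def power2_eq_square)
    finally have "seq_inner (\<lambda>j. x n j + (-1) *\<^sub>R x m j) (\<lambda>j. x n j + (-1) *\<^sub>R x m j) \<le> 2 * \<eta> n + 2 * \<eta> m"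
      using par Qx(1)[of n] Qx(1)[of m] by simp
    moreover have "(norm (x n j + (-1) *\<^sub>R x m j))\<^sup>2 \<le>
        seq_inner (\<lambda>j. x n j + (-1) *\<^sub>R x m j) (\<lambda>j. x n j + (-1) *\<^sub>R x m j)"
      by (rule norm_le_seq_inner[OF abs_summable_lin[OF x x]])
    ultimately show ?thesis by simp
  qed
  have "convergent (\<lambda>n. x n j)" for j
  proof (rule Cauchy_convergent, rule metric_CauchyI)
    fix e :: real assume "e > 0"
    then have "\<forall>\<^sub>F n in sequentially. \<eta> n < e\<^sup>2 / 4"
      using \<eta>0 by (intro order_tendstoD) auto
    then obtain N where N: "\<And>n. n \<ge> N \<Longrightarrow> \<eta> n < e\<^sup>2 / 4"
      by (auto simp: eventually_sequentially)
    have "dist (x m j) (x n j) < e" if "m \<ge> N" "n \<ge> N" for m n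
    proof -
      have "(norm (x m j - x n j))\<^sup>2 < e\<^sup>2"
        using Cauchy_bound[where n = m and m = n and j = j] N[OF that(1)] N[OF that(2)] by simp
      then show ?thesis
        using \<open>e > 0\<close> by (simp add: dist_norm power2_less_imp_less)
    qed
    then show "\<exists>M. \<forall>m\<ge>M. \<forall>n\<ge>M. dist (x m j) (x n j) < e" by blast
  qed
  then obtain y where y: "(\<lambda>n. x n j) \<longlonglongrightarrow> y j" for j
    by (auto simp: convergent_def) metis
  have x_le: "norm (x n j) \<le> sqrt (D + 1)" for n j
    using norm_le_seq_inner[OF x, of n j] Qx(1)[of n] \<eta>(2)[of n] by (intro real_le_rsqrt) simp
  have y_le: "norm (y j) \<le> sqrt (D + 1)" for j
    using tendsto_norm[OF y[of j]] x_le by (intro tendsto_upperbound) auto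
  \<comment> \<open>Dominated convergence: the residuals share the coordinatewise bound
    \<open>sqrt (D + 1)\<close>, and \<open>w\<close> is absolutely summable.\<close>
  have lim: "(\<lambda>n. seq_inner w (x n)) \<longlonglongrightarrow> seq_inner w y" if w: "summable (\<lambda>j. norm (w j))" for w
    unfolding seq_inner_def
  proof (rule tannerys_theorem[THEN conjunct2, THEN conjunct2])
    show "(\<lambda>n. w j \<bullet> x n j) \<longlonglongrightarrow> w j \<bullet> y j" for j by (intro tendsto_intros y)
    show "summable (\<lambda>j. norm (w j) * sqrt (D + 1))" by (intro summable_mult2 w)
    have "norm (w j \<bullet> x n j) \<le> norm (w j) * sqrt (D + 1)" for n j
      using Cauchy_Schwarz_ineq2[of "w j" "x n j"] mult_left_mono[OF x_le[of n j], of "norm (w j)"]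
      by simp
    then show "\<forall>\<^sub>F (k, n) in sequentially \<times>\<^sub>F sequentially. norm (w k \<bullet> x n k) \<le> norm (w k) * sqrt (D + 1)"
      by (simp add: case_prod_unfold)
  qed simp
  have lim0: "(\<lambda>n. seq_inner (w n) (x n)) \<longlonglongrightarrow> 0"
    if w: "\<And>n. w n \<in> V" and bound: "\<And>n. seq_inner (w n) (w n) \<le> C" for w C
  proof -
    have "(\<lambda>n. (seq_inner (w n) (x n))\<^sup>2) \<longlonglongrightarrow> 0"
    proof (rule tendsto_sandwich[where f = "\<lambda>_. 0" and h = "\<lambda>n. C * \<eta> n"])
      show "\<forall>\<^sub>F n in sequentially. (seq_inner (w n) (x n))\<^sup>2 \<le> C * \<eta> n"
      proof (intro always_eventually allI)
        fix n
        have "seq_inner (w n) (x n) = seq_inner (x n) (w n)"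
          by (rule seq_inner_commute)
        then show "(seq_inner (w n) (x n))\<^sup>2 \<le> C * \<eta> n"
          using order_trans[OF almost_orth[OF w, of n n] mult_right_mono[OF bound[of n]]] \<eta>(1)[of n]
          by simp
      qed
      show "(\<lambda>n. C * \<eta> n) \<longlonglongrightarrow> 0" using tendsto_mult_right_zero[OF \<eta>0] .
    qed auto
    then show ?thesis by simp
  qed
  have y0: "y j = 0" for j
  proof (rule orth[OF y_le])
    fix w assume w: "w \<in> V"
    have "(\<lambda>n. seq_inner w (x n)) \<longlonglongrightarrow> 0" using w by (intro lim0) auto
    with lim[OF V[OF w]] have "seq_inner w y = 0" by (rule LIMSEQ_unique)
    then show "(\<Sum>j. w j \<bullet> y j) = 0" by (simp add: seq_inner_def)
  qed
  \<comment> \<open>The square of \<open>x n\<close> is the product of \<open>q\<close> with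
    \<open>x n\<close> minus that of \<open>v n\<close> with \<open>x n\<close>. The first tends to
    0 because the coordinatewise limit \<open>y\<close> vanishes, the second by almost
    orthogonality, as the \<open>v n\<close> are bounded.\<close>
  have "(\<lambda>n. seq_inner q (x n)) \<longlonglongrightarrow> 0"
    using lim[OF q] by (simp add: y0 seq_inner_def)
  moreover have "(\<lambda>n. seq_inner (v n) (x n)) \<longlonglongrightarrow> 0"
  proof (rule lim0[OF v(1)])
    fix n
    have "v n = (\<lambda>j. q j + (-1) *\<^sub>R x n j)" by (auto simp: x_def)
    then have "seq_inner (v n) (v n) = seq_inner q q - 2 * seq_inner q (x n) + seq_inner (x n) (x n)"
      using seq_inner_square[OF q x[of n], of "-1"] by simp
    \<comment> \<open>Adding the square of \<open>q + x n\<close>, which is nonnegative, removes the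
      mixed term.\<close>
    moreover have "0 \<le> seq_inner q q + 2 * seq_inner q (x n) + seq_inner (x n) (x n)"
      using seq_inner_square[OF q x[of n], of 1] seq_inner_nonneg[OF abs_summable_lin[OF q x[of n], of 1]]
      by simp
    ultimately show "seq_inner (v n) (v n) \<le> 2 * seq_inner q q + 2 * (D + 1)"
      using Qx(1)[of n] \<eta>(2)[of n] by simp
  qed
  ultimately have "(\<lambda>n. seq_inner q (x n) + (-1) * seq_inner (v n) (x n)) \<longlonglongrightarrow> 0 + (-1) * 0"
    by (intro tendsto_intros)
  moreover have "seq_inner q (x n) + (-1) * seq_inner (v n) (x n) = seq_inner (x n) (x n)" for n
    using seq_inner_lin_left[OF q V[OF v(1)] x, where t = "-1"] by (simp add: x_def)
  ultimately have "(\<lambda>n. seq_inner (x n) (x n)) \<longlonglongrightarrow> 0" by simp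
  then have "\<forall>\<^sub>F n in sequentially. seq_inner (x n) (x n) < \<epsilon>\<^sup>2"
    using \<open>\<epsilon> > 0\<close> by (intro order_tendstoD) auto
  then obtain n where n: "seq_inner (x n) (x n) < \<epsilon>\<^sup>2"
    by (auto simp: eventually_sequentially)
  show thesis
  proof (rule that[OF v(1)[of n]])
    fix j
    have "(norm (x n j))\<^sup>2 \<le> \<epsilon>\<^sup>2"
      using norm_le_seq_inner[OF x, of n j] n by linarith
    then have "norm (x n j) \<le> \<epsilon>"
      using \<open>\<epsilon> > 0\<close> by (rule power2_le_imp_le[of _ \<epsilon>, OF _ less_imp_le])
    then show "norm (q j - v n j) \<le> \<epsilon>" by (simp add: x_def)
  qed
qed

text \<open>Hahn-Banach for weighted coefficient spaces: a functional annihilating all the exponentials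
  would have a Fourier-Borel transform of exponential type that vanishes on \<open>U\<close>.\<close>

lemma unicity_set_imp_dense:
  assumes U: "unicity_set U"
    and G: "G \<subseteq> entire_functions"
    and G0: "(\<lambda>z. 0) \<in> G"
    and Gadd: "\<And>f g. f \<in> G \<Longrightarrow> g \<in> G \<Longrightarrow> (\<lambda>z. f z + g z) \<in> G"
    and Gcmult: "\<And>f c. f \<in> G \<Longrightarrow> (\<lambda>z. c * f z) \<in> G"
    and Gexp: "\<And>w. w \<in> U \<Longrightarrow> (\<lambda>z. exp (w * z)) \<in> G"
    and q: "q \<in> entire_functions" and "\<epsilon> > 0"
  obtains g where "g \<in> G" "\<And>z. z \<in> cball 0 R \<Longrightarrow> cmod (g z - q z) \<le> \<epsilon>"
proof -
  \<comment> \<open>Weights are taken at twice the radius \<open>r\<close>, so that uniformly small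
    weighted coefficients decay like \<open>1 / 2 ^ j\<close> on the disc of radius
    \<open>r\<close>. The maximum with 1 keeps the radius positive.\<close>
  define r \<rho> where "r = max R 1" and "\<rho> = 2 * r"
  have r: "r \<ge> R" "r > 0" "\<rho> > 0" by (auto simp: r_def \<rho>_def)
  define co where "co g = (\<lambda>j. taylor_coeff g j * of_real \<rho> ^ j)" for g
  have co_summable: "summable (\<lambda>j. norm (co g j))" if g: "g \<in> entire_functions" for g
  proof -
    obtain B where B: "\<And>z. z \<in> cball 0 (2 * \<rho>) \<Longrightarrow> cmod (g z) \<le> B"
      using entire_bounded_cball[OF g] by metis
    have "norm (co g j) \<le> B * (1/2) ^ j" for j
      using norm_taylor_coeff_le[OF g _ B, of "2 * \<rho>" j] r
      by (simp add: co_def norm_mult norm_power power_mult_distrib power_one_over field_simps)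
    then show ?thesis
      by (intro summable_comparison_test'[OF summable_mult[OF summable_geometric[of "1/2::real"]]]) auto
  qed
  have entire: "g \<in> entire_functions" if "g \<in> G" for g using that G by blast
  \<comment> \<open>Half of \<open>\<epsilon>\<close>, because summing the geometric series doubles
    the bound.\<close>
  obtain v where v: "v \<in> co ` G" "\<And>j. norm (co q j - v j) \<le> \<epsilon> / 2"
  proof (rule dense_if_orthogonal_trivial[of "co ` G" "co q" "\<epsilon> / 2"])
    show "summable (\<lambda>j. norm (v j))" if "v \<in> co ` G" for v
      using that co_summable entire by auto
    have "co (\<lambda>z. 0) = (\<lambda>j. 0)" by (simp add: co_def taylor_coeff_def)
    then show "(\<lambda>j. 0) \<in> co ` G" using G0 by (metis image_eqI)
    show "(\<lambda>j. v j + t *\<^sub>R w j) \<in> co ` G" if vw: "v \<in> co ` G" "w \<in> co ` G" for v w and t :: real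
    proof -
      obtain f g where fg: "f \<in> G" "g \<in> G" "v = co f" "w = co g" using vw by blast
      then have "(\<lambda>j. v j + t *\<^sub>R w j) = co (\<lambda>z. f z + of_real t * g z)"
        by (auto simp: co_def taylor_coeff_add taylor_coeff_cmult entire entire_cmult scaleR_conv_of_real
            algebra_simps)
      then show ?thesis using fg Gadd Gcmult by blast
    qed
    show "summable (\<lambda>j. norm (co q j))" by (rule co_summable[OF q])
    show "\<epsilon> / 2 > 0" using \<open>\<epsilon> > 0\<close> by simp
  next
    fix y :: "nat \<Rightarrow> complex" and B j
    assume B: "\<And>j. norm (y j) \<le> B" and orth: "\<And>v. v \<in> co ` G \<Longrightarrow> (\<Sum>j. v j \<bullet> y j) = 0"
    \<comment> \<open>Taylor coefficients of the Fourier-Borel transform, that is, of the pairing of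
      \<open>y\<close> with \<open>exp (w * z)\<close> as a function of \<open>w\<close>. The
      conjugate makes the pairing complex linear.\<close>
    define b where "b j = of_real \<rho> ^ j / fact j * cnj (y j)" for j
    have exp_sums: "(\<lambda>j. \<bar>B\<bar> * ((\<rho> * cmod w) ^ j /\<^sub>R fact j)) sums (\<bar>B\<bar> * exp (\<rho> * cmod w))" for w
      by (intro sums_mult exp_converges)
    have b_le: "norm (b j * w ^ j) \<le> \<bar>B\<bar> * ((\<rho> * cmod w) ^ j /\<^sub>R fact j)" for w j
    proof -
      have "norm (b j * w ^ j) = cmod (y j) * ((\<rho> * cmod w) ^ j / fact j)"
        using r by (simp add: b_def norm_mult norm_divide norm_power power_mult_distrib)
      also have "\<dots> \<le> \<bar>B\<bar> * ((\<rho> * cmod w) ^ j / fact j)"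
        using B[of j] r by (intro mult_right_mono) auto
      finally show ?thesis by (simp add: divide_inverse mult.commute)
    qed
    have b_summable: "summable (\<lambda>j. b j * w ^ j)" for w
      by (rule summable_comparison_test'[OF sums_summable[OF exp_sums] b_le])
    define \<Phi> where "\<Phi> w = (\<Sum>j. b j * w ^ j)" for w
    have \<Phi>_sums: "(\<lambda>j. b j * w ^ j) sums \<Phi> w" for w
      unfolding \<Phi>_def by (rule summable_sums[OF b_summable])
    \<comment> \<open>The summand 1 provides the strictly positive constant that exponential type
      demands.\<close>
    have "cmod (\<Phi> w) \<le> (\<bar>B\<bar> + 1) * exp (\<rho> * cmod w)" for w
    proof -
      have "cmod (\<Phi> w) \<le> \<bar>B\<bar> * exp (\<rho> * cmod w)"
        unfolding \<Phi>_def using norm_suminf_le[OF b_le sums_summable[OF exp_sums]] exp_sums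
        by (simp add: sums_iff)
      then show ?thesis
        unfolding distrib_right using exp_gt_zero[of "\<rho> * cmod w"] by linarith
    qed
    moreover have "\<bar>B\<bar> + 1 > 0" by simp
    moreover have "\<Phi> holomorphic_on UNIV"
      using taylor_coeff_eqI(1)[of b \<Phi>, OF \<Phi>_sums] by (rule entireD)
    ultimately have "\<Phi> \<in> exponential_type"
      unfolding exponential_type_def using r(3) by blast
    moreover have "\<Phi> w = 0" if "w \<in> U" for w
    proof -
      have exp_coeff: "taylor_coeff (\<lambda>z. exp (w * z)) j = w ^ j / fact j" for j
      proof (rule taylor_coeff_eqI(2))
        show "(\<lambda>j. w ^ j / fact j * z ^ j) sums exp (w * z)" for z
          using exp_converges[of "w * z"]
          by (simp add: scaleR_conv_of_real power_mult_distrib field_simps)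
      qed
      \<comment> \<open>Orthogonality controls only real parts. Since \<open>G\<close> admits
        complex multiples, the choices 1 and \<open>- \<i>\<close> of \<open>c\<close> give the real
        and imaginary parts of \<open>\<Phi> w\<close>.\<close>
      have "Re (c * \<Phi> w) = 0" for c
      proof -
        have e: "(\<lambda>z. c * exp (w * z)) \<in> G" using Gexp[OF that] Gcmult by blast
        have "co (\<lambda>z. c * exp (w * z)) j \<bullet> y j = Re (c * (b j * w ^ j))" for j
        proof -
          have "co (\<lambda>z. c * exp (w * z)) j * cnj (y j) = c * (b j * w ^ j)"
            using entire[OF Gexp[OF that]] by (simp add: co_def taylor_coeff_cmult exp_coeff b_def)
          moreover have "u \<bullet> v = Re (u * cnj v)" for u v :: complex
            by (simp add: inner_complex_def)
          ultimately show ?thesis by metis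
        qed
        then have "(\<Sum>j. Re (c * (b j * w ^ j))) = 0"
          using orth[of "co (\<lambda>z. c * exp (w * z))"] e by simp
        moreover have "(\<lambda>j. Re (c * (b j * w ^ j))) sums Re (c * \<Phi> w)"
          by (intro sums_Re sums_mult \<Phi>_sums)
        ultimately show ?thesis by (simp add: sums_iff)
      qed
      from this[of 1] this[of "- \<i>"] show ?thesis by (simp add: complex_eq_iff)
    qed
    ultimately have "\<Phi> = (\<lambda>w. 0)"
      using U by (auto simp: unicity_set_def)
    then have "b j = 0"
      using taylor_coeff_eqI(2)[of b \<Phi> j, OF \<Phi>_sums] by (simp add: taylor_coeff_def)
    then show "y j = 0" using r by (simp add: b_def)
  qed (rule that)
  obtain g where g: "g \<in> G" "v = co g" using v(1) by blast
  have "cmod (g z - q z) \<le> \<epsilon>" if "z \<in> cball 0 R" for z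
  proof -
    have "cmod (g z - q z) \<le> 2 * (\<epsilon> / 2) / 2 ^ 0"
    proof (rule norm_entire_le_geometric[where f = "\<lambda>z. g z - q z" and r = r])
      fix j
      have "co q j - v j = - taylor_coeff (\<lambda>z. g z - q z) j * of_real \<rho> ^ j"
        using g q entire by (simp add: co_def taylor_coeff_diff algebra_simps)
      then have "cmod (taylor_coeff (\<lambda>z. g z - q z) j) * \<rho> ^ j \<le> \<epsilon> / 2"
        using v(2)[of j] r by (simp add: norm_mult norm_power)
      then show "cmod (taylor_coeff (\<lambda>z. g z - q z) j) * r ^ j \<le> \<epsilon> / 2 / 2 ^ j"
        by (simp add: \<rho>_def power_mult_distrib field_simps)
    qed (use g q entire that r in \<open>auto intro: entire_diff\<close>)
    then show ?thesis by simp
  qed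
  with g that show thesis by blast
qed

subsection \<open>Small approximate preimages\<close>

text \<open>The preimages are exact and only their size is asymptotic, so these targets form a
  vector space; approximation enters solely through the density of this space.\<close>

definition solvable_targets :: "(nat \<Rightarrow> complex poly) \<Rightarrow> nat filter \<Rightarrow> (complex \<Rightarrow> complex) set" where
  "solvable_targets P F = {g. \<exists>h. (\<forall>n. h n \<in> entire_functions) \<and>
     (\<forall>\<^sub>F n in F. poly_D (P n) (h n) = g) \<and>
     (\<forall>R. \<forall>\<delta>>0. \<forall>\<^sub>F n in F. \<forall>z\<in>cball 0 R. cmod (h n z) \<le> \<delta>)}"

lemma solvable_targets_entire:
  assumes "F \<noteq> bot" "g \<in> solvable_targets P F"
  shows "g \<in> entire_functions"
proof -
  obtain h where h: "\<And>n. h n \<in> entire_functions" "\<forall>\<^sub>F n in F. poly_D (P n) (h n) = g"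
    using assms(2) by (auto simp: solvable_targets_def)
  then show ?thesis
    using eventually_happens'[OF assms(1) h(2)] entire_poly_D by blast
qed

lemma solvable_targets_zero: "(\<lambda>z. 0) \<in> solvable_targets P F"
  unfolding solvable_targets_def
  by (intro CollectI exI[of _ "\<lambda>n z. 0"]) (simp add: poly_D_zero entire_functions_def)

lemma solvable_targets_add:
  assumes "f \<in> solvable_targets P F" "g \<in> solvable_targets P F"
  shows "(\<lambda>z. f z + g z) \<in> solvable_targets P F"
proof -
  obtain h where h: "\<And>n. h n \<in> entire_functions" "\<forall>\<^sub>F n in F. poly_D (P n) (h n) = f"
    "\<And>R \<delta>. \<delta> > 0 \<Longrightarrow> \<forall>\<^sub>F n in F. \<forall>z\<in>cball 0 R. cmod (h n z) \<le> \<delta>"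
    using assms(1) by (auto simp: solvable_targets_def)
  obtain k where k: "\<And>n. k n \<in> entire_functions" "\<forall>\<^sub>F n in F. poly_D (P n) (k n) = g"
    "\<And>R \<delta>. \<delta> > 0 \<Longrightarrow> \<forall>\<^sub>F n in F. \<forall>z\<in>cball 0 R. cmod (k n z) \<le> \<delta>"
    using assms(2) by (auto simp: solvable_targets_def)
  have "\<forall>\<^sub>F n in F. poly_D (P n) (\<lambda>z. h n z + k n z) = (\<lambda>z. f z + g z)"
    using h(2) k(2) by eventually_elim (simp add: poly_D_add h k)
  moreover have "\<forall>\<^sub>F n in F. \<forall>z\<in>cball 0 R. cmod (h n z + k n z) \<le> \<delta>" if "\<delta> > 0" for R \<delta> :: real
  proof -
    have "\<delta> / 2 > 0" using that by simp
    from h(3)[OF this, of R] k(3)[OF this, of R] show ?thesis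
    proof eventually_elim
      case (elim n)
      show ?case
      proof
        fix z assume "z \<in> cball (0::complex) R"
        with elim have "cmod (h n z) \<le> \<delta> / 2" "cmod (k n z) \<le> \<delta> / 2" by blast+
        then show "cmod (h n z + k n z) \<le> \<delta>"
          using norm_triangle_ineq[of "h n z" "k n z"] by linarith
      qed
    qed
  qed
  ultimately show ?thesis
    unfolding solvable_targets_def
    by (intro CollectI exI[of _ "\<lambda>n z. h n z + k n z"]) (auto intro: entire_add h k)
qed

lemma solvable_targets_cmult:
  assumes "f \<in> solvable_targets P F"
  shows "(\<lambda>z. c * f z) \<in> solvable_targets P F"
proof -
  obtain h where h: "\<And>n. h n \<in> entire_functions" "\<forall>\<^sub>F n in F. poly_D (P n) (h n) = f"
    "\<And>R \<delta>. \<delta> > 0 \<Longrightarrow> \<forall>\<^sub>F n in F. \<forall>z\<in>cball 0 R. cmod (h n z) \<le> \<delta>"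
    using assms(1) by (auto simp: solvable_targets_def)
  have "\<forall>\<^sub>F n in F. poly_D (P n) (\<lambda>z. c * h n z) = (\<lambda>z. c * f z)"
    using h(2) by eventually_elim (simp add: poly_D_cmult h)
  moreover have "\<forall>\<^sub>F n in F. \<forall>z\<in>cball 0 R. cmod (c * h n z) \<le> \<delta>" if "\<delta> > 0" for R \<delta> :: real
  proof -
    have "\<delta> / (cmod c + 1) > 0" using that by (simp add: add_nonneg_pos)
    from h(3)[OF this, of R] show ?thesis
    proof eventually_elim
      case (elim n)
      show ?case
      proof
        fix z assume "z \<in> cball (0::complex) R"
        then have "cmod (h n z) \<le> \<delta> / (cmod c + 1)" using elim by blast
        then have "cmod c * cmod (h n z) \<le> cmod c * (\<delta> / (cmod c + 1))"
          by (intro mult_left_mono) auto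
        also have "\<dots> = \<delta> * (cmod c / (cmod c + 1))" by simp
        also have "\<dots> \<le> \<delta> * 1"
          using that by (intro mult_left_mono) (auto simp: divide_le_eq_1_pos add_nonneg_pos)
        finally show "cmod (c * h n z) \<le> \<delta>" by (simp add: norm_mult)
      qed
    qed
  qed
  ultimately show ?thesis
    unfolding solvable_targets_def
    by (intro CollectI exI[of _ "\<lambda>n z. c * h n z"]) (auto intro: entire_cmult h)
qed

lemma solvable_targets_sum:
  assumes "finite I" "\<And>i. i \<in> I \<Longrightarrow> f i \<in> solvable_targets P F"
  shows "(\<lambda>z. \<Sum>i\<in>I. f i z) \<in> solvable_targets P F"
  using assms by (induction I rule: finite_induct)
    (auto intro: solvable_targets_zero solvable_targets_add)

lemma exp_in_solvable_targets:
  assumes lim: "filterlim (\<lambda>n. cmod (poly (P n) w)) at_top F"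
  shows "(\<lambda>z. exp (w * z)) \<in> solvable_targets P F"
proof -
  define h where "h n = (\<lambda>z. inverse (poly (P n) w) * exp (w * z))" for n
  have exp_entire: "(\<lambda>z. exp (w * z)) \<in> entire_functions"
    by (intro entireI holomorphic_intros)
  have h_entire: "h n \<in> entire_functions" for n
    unfolding h_def by (intro entire_cmult exp_entire)
  have "\<forall>\<^sub>F n in F. poly_D (P n) (h n) = (\<lambda>z. exp (w * z))"
    using filterlim_at_top_dense[THEN iffD1, OF lim, rule_format, of 0]
  proof eventually_elim
    case (elim n)
    then show ?case
      unfolding h_def by (subst poly_D_cmult) (auto simp: exp_entire poly_D_exp)
  qed
  moreover have "\<forall>\<^sub>F n in F. \<forall>z\<in>cball 0 R. cmod (h n z) \<le> \<delta>" if "\<delta> > 0" for R \<delta> :: real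
    using filterlim_at_top_dense[THEN iffD1, OF lim, rule_format, of "max 0 (exp (cmod w * R) / \<delta>)"]
  proof eventually_elim
    case (elim n)
    show ?case
    proof
      fix z assume z: "z \<in> cball (0::complex) R"
      have "cmod (exp (w * z)) \<le> exp (cmod w * R)"
        unfolding norm_exp_eq_Re exp_le_cancel_iff
        using complex_Re_le_cmod[of "w * z", unfolded norm_mult] mult_left_mono[of "cmod z" R "cmod w"] z
        by (smt (verit) mem_cball_0 norm_ge_zero)
      moreover have "exp (cmod w * R) < \<delta> * cmod (poly (P n) w)" "cmod (poly (P n) w) > 0"
        using elim that by (auto simp: field_simps)
      moreover have "cmod (h n z) = cmod (exp (w * z)) / cmod (poly (P n) w)"
        unfolding h_def norm_mult norm_inverse divide_inverse by (rule mult.commute)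
      ultimately show "cmod (h n z) \<le> \<delta>"
        by (simp only: pos_divide_le_eq)
    qed
  qed
  ultimately show ?thesis
    unfolding solvable_targets_def
    by (intro CollectI exI[of _ h]) (auto intro: h_entire)
qed

section \<open>Preimages of monomials under (Q), and density of the solvable targets\<close>

lemma power_le_exp_mult_fact: "real m ^ m \<le> exp 1 ^ m * fact m"
proof -
  \<comment> \<open>A crude Stirling bound: a single term of the exponential series at
    \<open>m\<close> is at most the whole sum.\<close>
  have "real m ^ m /\<^sub>R fact m \<le> (\<Sum>j. real m ^ j /\<^sub>R fact j)"
    using sum_le_suminf[OF summable_exp_generic[of "real m"], of "{m}"] by simp
  also have "\<dots> = exp (real m)" by (simp add: exp_def)
  also have "\<dots> = exp 1 ^ m" using exp_of_nat_mult[of m "1::real"] by simp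
  finally show ?thesis by (simp add: field_simps)
qed

lemma taylor_coeff_monomial: "taylor_coeff (\<lambda>z. z ^ N / fact N) j = (if j = N then 1 / fact N else 0)"
proof -
  have "(\<lambda>z::complex. z ^ N / fact N) = poly (monom (1 / fact N) N)" by (auto simp: poly_monom)
  then show ?thesis by (simp add: taylor_coeff_poly)
qed

lemma entire_monomial: "(\<lambda>z. z ^ N / fact N) \<in> entire_functions"
  by (auto intro!: entireI holomorphic_intros)

text \<open>Differentiation shifts the normalised monomials \<open>z ^ N / fact N\<close> down by
  one index, so \<open>p\<close> acts on them as a convolution.\<close>

lemma poly_D_monomial:
  "poly_D p (\<lambda>z. z ^ N / fact N) = (\<lambda>z. \<Sum>i\<le>N. coeff p (N - i) * (z ^ i / fact i))"
proof (rule entire_eqI)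
  have rhs: "(\<lambda>z. \<Sum>i\<le>N. coeff p (N - i) * (z ^ i / fact i)) =
      poly (poly_of_coeffs (\<lambda>i. coeff p (N - i) / fact i) (Suc N))"
    by (auto simp: poly_of_coeffs_def poly_sum poly_monom lessThan_Suc_atMost)
  have d: "(deriv ^^ l) (\<lambda>z::complex. z ^ N / fact N) 0 = (if l = N then 1 else 0)" for l
    using taylor_coeff_monomial[of N l] by (auto simp: taylor_coeff_def split: if_splits)
  fix i
  have "(deriv ^^ i) (poly_D p (\<lambda>z. z ^ N / fact N)) 0 =
      (\<Sum>j\<le>degree p. if j = N - i \<and> i \<le> N then coeff p j else 0)"
    unfolding higher_deriv_poly_D[OF entire_monomial] d by (intro sum.cong) auto
  also have "\<dots> = (if i \<le> N then coeff p (N - i) else 0)"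
    by (auto simp: coeff_eq_0)
  finally show "taylor_coeff (poly_D p (\<lambda>z. z ^ N / fact N)) i =
      taylor_coeff (\<lambda>z. \<Sum>i\<le>N. coeff p (N - i) * (z ^ i / fact i)) i"
    unfolding rhs taylor_coeff_poly by (simp add: taylor_coeff_def coeff_poly_of_coeffs)
next
  show "poly_D p (\<lambda>z. z ^ N / fact N) \<in> entire_functions"
    by (intro entire_poly_D entire_monomial)
  show "(\<lambda>z. \<Sum>i\<le>N. coeff p (N - i) * (z ^ i / fact i)) \<in> entire_functions"
    by (intro entire_sum entire_cmult entire_monomial)
qed

lemma coeff_valence_nonzero:
  assumes "p \<noteq> 0"
  shows "coeff p (valence p) \<noteq> 0"
proof -
  have "\<exists>j. coeff p j \<noteq> 0" using assms by (metis leading_coeff_0_iff)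
  then show ?thesis unfolding valence_def by (rule LeastI_ex)
qed

lemma coeff_less_valence: "j < valence p \<Longrightarrow> coeff p j = 0"
  unfolding valence_def by (meson not_less_Least)

context
  fixes P :: "nat \<Rightarrow> complex poly" and F :: "nat filter"
  assumes F: "F \<le> sequentially" and val: "filterlim (\<lambda>n. valence (P n)) at_top F"
begin

abbreviation "low_coeff n \<equiv> cmod (coeff (P n) (valence (P n)))"

text \<open>With \<open>m\<close> the valence and \<open>c\<close> the modulus of the lowest
  coefficient, the m-th power of the growth condition reads
  \<open>(2 * r * exp 1) ^ m \<le> m ^ m * c ^ \<kappa>\<close>. The bound of \<open>m ^ m\<close>
  by \<open>exp 1 ^ m * fact m\<close> turns it into
  \<open>(2 * r) ^ m \<le> fact m * c ^ \<kappa>\<close>, and the surplus \<open>2 ^ m\<close>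
  eventually beats \<open>r ^ k / \<delta>\<close>.\<close>

lemma property_Q_fact_bound:
  assumes Q: "property_Q P" and "\<delta> > 0" and "\<kappa> \<ge> 1"
  shows "\<forall>\<^sub>F n in F. \<forall>z\<in>cball 0 R.
    cmod (z ^ (k + valence (P n)) / fact (k + valence (P n))) \<le> \<delta> * low_coeff n ^ \<kappa>"
proof -
  define r where "r = max R 1"
  have r: "r \<ge> 1" "r \<ge> R" by (auto simp: r_def)
  have "filterlim (\<lambda>n. real (valence (P n)) * low_coeff n powr (real \<kappa> / real (valence (P n)))) at_top F"
    using Q \<open>\<kappa> \<ge> 1\<close> F by (auto simp: property_Q_def intro: filterlim_mono)
  then have ev1: "\<forall>\<^sub>F n in F. real (valence (P n)) * low_coeff n powr (real \<kappa> / real (valence (P n)))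
      \<ge> 2 * r * exp 1"
    by (simp add: filterlim_at_top)
  have "\<forall>\<^sub>F m in sequentially. r ^ k / 2 ^ m < \<delta>"
    using LIMSEQ_divide_realpow_zero[of 2 "r ^ k"] \<open>\<delta> > 0\<close> by (auto dest: order_tendstoD)
  then have "\<forall>\<^sub>F n in F. r ^ k / 2 ^ valence (P n) < \<delta>"
    using val by (rule eventually_compose_filterlim)
  then have ev2: "\<forall>\<^sub>F n in F. \<delta> * 2 ^ valence (P n) \<ge> r ^ k"
    by eventually_elim (simp add: field_simps)
  have ev3: "\<forall>\<^sub>F n in F. valence (P n) \<ge> 1"
    using val by (simp add: filterlim_at_top)
  from ev1 ev2 ev3 show ?thesis
  proof eventually_elim
    case (elim n)
    define m c where "m = valence (P n)" and "c = low_coeff n"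
    have m: "m \<ge> 1" using elim by (simp add: m_def)
    \<comment> \<open>\<open>powr\<close> is 0 at base 0, so a vanishing coefficient would
      contradict the lower bound.\<close>
    have "c > 0"
    proof (rule ccontr)
      assume "\<not> c > 0"
      then have "c = 0" by (simp add: c_def)
      then show False using elim(1) r by (simp add: c_def mult_le_0_iff)
    qed
    have "(2 * r * exp 1) ^ m \<le> (real m * c powr (real \<kappa> / real m)) ^ m"
      using elim(1) r by (intro power_mono) (auto simp: m_def c_def)
    also have "\<dots> = real m ^ m * c ^ \<kappa>"
      using \<open>c > 0\<close> m by (simp add: power_mult_distrib powr_realpow[symmetric] powr_powr)
    also have "\<dots> \<le> exp 1 ^ m * fact m * c ^ \<kappa>"
      using \<open>c > 0\<close> by (intro mult_right_mono power_le_exp_mult_fact) auto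
    also have "(2 * r * exp 1) ^ m = exp 1 ^ m * (2 * r) ^ m" by (simp add: power_mult_distrib)
    finally have "(2 * r) ^ m \<le> fact m * c ^ \<kappa>"
      by (simp only: mult.assoc mult_le_cancel_left_pos zero_less_power exp_gt_zero)
    have "r ^ k * r ^ m \<le> \<delta> * 2 ^ m * r ^ m"
      using elim(2) r by (intro mult_right_mono) (auto simp: m_def)
    also have "\<dots> = \<delta> * (2 * r) ^ m" by (simp add: power_mult_distrib)
    also have "\<dots> \<le> \<delta> * (fact m * c ^ \<kappa>)"
      using \<open>\<delta> > 0\<close> by (intro mult_left_mono \<open>(2 * r) ^ m \<le> fact m * c ^ \<kappa>\<close>) auto
    also have "\<dots> \<le> \<delta> * (fact (k + m) * c ^ \<kappa>)"
      using \<open>\<delta> > 0\<close> \<open>c > 0\<close> by (intro mult_left_mono mult_right_mono fact_mono) auto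
    finally have *: "r ^ (k + m) / fact (k + m) \<le> \<delta> * c ^ \<kappa>"
      by (simp add: power_add divide_simps mult_ac)
    show ?case
    proof
      fix z assume z: "z \<in> cball (0::complex) R"
      have "cmod z ^ (k + m) / fact (k + m) \<le> r ^ (k + m) / fact (k + m)"
        using z r by (intro divide_right_mono power_mono) auto
      with * have "cmod z ^ (k + m) / fact (k + m) \<le> \<delta> * c ^ \<kappa>" by simp
      then show "cmod (z ^ (k + valence (P n)) / fact (k + valence (P n))) \<le> \<delta> * low_coeff n ^ \<kappa>"
        by (simp add: norm_divide norm_power m_def c_def)
    qed
  qed
qed

text \<open>The extra factor \<open>\<bar>c\<bar> ^ \<kappa>\<close> absorbs the divisions by the lowest coefficient when
  \<open>P n\<close> is inverted recursively on polynomials.\<close>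

lemma property_Q_preimages:
  assumes Q: "property_Q P" and nz: "\<And>n. n \<ge> 1 \<Longrightarrow> P n \<noteq> 0"
  shows "\<exists>h. (\<forall>n. h n \<in> entire_functions) \<and>
    (\<forall>\<^sub>F n in F. poly_D (P n) (h n) = (\<lambda>z. z ^ k / fact k)) \<and>
    (\<forall>R \<kappa>. \<forall>\<delta>>0. \<forall>\<^sub>F n in F. \<forall>z\<in>cball 0 R. cmod (h n z) \<le> \<delta> * low_coeff n ^ \<kappa>)"
    (is "\<exists>h. ?S h k")
proof (induction k rule: less_induct)
  case (less k)
  then have "\<forall>i\<in>{..<k}. \<exists>h. ?S h i" by blast
  from bchoice[OF this] obtain h where "\<forall>i\<in>{..<k}. ?S (h i) i" by blast
  then have h: "\<And>i n. i < k \<Longrightarrow> h i n \<in> entire_functions"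
    "\<And>i. i < k \<Longrightarrow> \<forall>\<^sub>F n in F. poly_D (P n) (h i n) = (\<lambda>z. z ^ i / fact i)"
    "\<And>i R \<kappa> \<delta>. i < k \<Longrightarrow> \<delta> > 0 \<Longrightarrow>
      \<forall>\<^sub>F n in F. \<forall>z\<in>cball 0 R. cmod (h i n z) \<le> \<delta> * low_coeff n ^ \<kappa>"
    by auto
  have "\<exists>B. \<forall>n\<ge>1. cmod (coeff (P n) (j + valence (P n))) \<le> B" if "j \<ge> 1" for j
  proof -
    have "bounded ((\<lambda>n. coeff (P n) (j + valence (P n))) ` {1..})"
      using Q that by (simp add: property_Q_def)
    then show ?thesis by (auto simp: bounded_iff)
  qed
  then obtain B where B: "\<And>j n. j \<ge> 1 \<Longrightarrow> n \<ge> 1 \<Longrightarrow> cmod (coeff (P n) (j + valence (P n))) \<le> B j"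
    by metis
  define c where "c n = coeff (P n) (valence (P n))" for n
  define b where "b n i = coeff (P n) (k - i + valence (P n))" for n i
  define u where "u n = (\<lambda>z::complex. z ^ (k + valence (P n)) / fact (k + valence (P n)))" for n
  \<comment> \<open>The operator sends \<open>u n\<close> to \<open>c n\<close> times the target
    plus lower normalised monomials with coefficients \<open>b n i\<close>. Subtracting the
    inductive preimages of the latter and dividing by \<open>c n\<close> leaves the target.\<close>
  define H where "H n = (\<lambda>z. inverse (c n) * (u n z - (\<Sum>i<k. b n i * h i n z)))" for n
  have ev_n: "\<forall>\<^sub>F n in F. n \<ge> 1"
    using F by (rule filter_leD) (rule eventually_ge_at_top)
  have u_entire: "u n \<in> entire_functions" for n unfolding u_def by (rule entire_monomial)
  have s_entire: "(\<lambda>z. \<Sum>i<k. b n i * h i n z) \<in> entire_functions" for n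
    using h by (intro entire_sum entire_cmult) auto
  have "H n \<in> entire_functions" for n
    unfolding H_def by (intro entire_cmult entire_diff u_entire s_entire)
  moreover have "\<forall>\<^sub>F n in F. poly_D (P n) (H n) = (\<lambda>z. z ^ k / fact k)"
  proof -
    have "\<forall>\<^sub>F n in F. \<forall>i\<in>{..<k}. poly_D (P n) (h i n) = (\<lambda>z. z ^ i / fact i)"
      using h by (intro eventually_ball_finite) auto
    with ev_n show ?thesis
    proof eventually_elim
      case (elim n)
      let ?m = "valence (P n)"
      have "c n \<noteq> 0" using coeff_valence_nonzero[OF nz[OF elim(1)]] by (simp add: c_def)
      have "poly_D (P n) (u n) z = (\<Sum>i\<le>k. coeff (P n) (k + ?m - i) * (z ^ i / fact i))" for z
      proof -
        have "poly_D (P n) (u n) z = (\<Sum>i\<le>k + ?m. coeff (P n) (k + ?m - i) * (z ^ i / fact i))"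
          unfolding u_def by (simp add: poly_D_monomial)
        \<comment> \<open>For \<open>i > k\<close> the coefficient index lies below the
          valence.\<close>
        also have "\<dots> = (\<Sum>i\<le>k. coeff (P n) (k + ?m - i) * (z ^ i / fact i))"
          by (rule sum.mono_neutral_right) (auto intro!: coeff_less_valence)
        finally show ?thesis .
      qed
      then have "poly_D (P n) (u n) z = c n * (z ^ k / fact k) + (\<Sum>i<k. b n i * (z ^ i / fact i))" for z
        by (simp add: b_def c_def lessThan_Suc_atMost[symmetric])
      moreover have "poly_D (P n) (\<lambda>z. \<Sum>i<k. b n i * h i n z) z = (\<Sum>i<k. b n i * (z ^ i / fact i))" for z
      proof -
        have "poly_D (P n) (\<lambda>z. \<Sum>i<k. b n i * h i n z) z = (\<Sum>i<k. poly_D (P n) (\<lambda>z. b n i * h i n z) z)"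
          using h by (subst poly_D_sum) (auto intro: entire_cmult)
        also have "\<dots> = (\<Sum>i<k. b n i * (z ^ i / fact i))"
          using h elim(2) by (intro sum.cong) (simp_all add: poly_D_cmult)
        finally show ?thesis .
      qed
      ultimately show ?case
        unfolding H_def using \<open>c n \<noteq> 0\<close>
        by (subst poly_D_cmult) (auto simp: poly_D_diff u_entire s_entire entire_diff)
    qed
  qed
  moreover have "\<forall>\<^sub>F n in F. \<forall>z\<in>cball 0 R. cmod (H n z) \<le> \<delta> * low_coeff n ^ \<kappa>"
    if "\<delta> > 0" for R \<delta> :: real and \<kappa>
  proof -
    define A where "A = (\<Sum>i<k. \<bar>B (k - i)\<bar>)"
    define \<delta>' where "\<delta>' = \<delta> / (1 + A)"
    have A: "A \<ge> 0" by (simp add: A_def sum_nonneg)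
    then have \<delta>': "\<delta>' > 0" using that by (simp add: \<delta>'_def)
    \<comment> \<open>The exponent is \<open>Suc \<kappa>\<close> because dividing by
      \<open>c n\<close> costs one power. The choice of \<open>\<delta>'\<close> shares
      \<open>\<delta>\<close> between \<open>u n\<close> and the lower terms, whose coefficients
      have moduli summing to at most \<open>A\<close>.\<close>
    have "\<forall>\<^sub>F n in F. \<forall>i\<in>{..<k}. \<forall>z\<in>cball 0 R. cmod (h i n z) \<le> \<delta>' * low_coeff n ^ Suc \<kappa>"
      by (intro eventually_ball_finite ballI h(3) \<delta>') auto
    moreover have "\<forall>\<^sub>F n in F. \<forall>z\<in>cball 0 R. cmod (u n z) \<le> \<delta>' * low_coeff n ^ Suc \<kappa>"
      unfolding u_def by (rule property_Q_fact_bound[OF Q \<delta>']) simp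
    ultimately show ?thesis using ev_n
    proof eventually_elim
      case (elim n)
      have c: "cmod (c n) > 0" using coeff_valence_nonzero[OF nz[OF elim(3)]] by (simp add: c_def)
      have low: "low_coeff n = cmod (c n)" by (simp add: c_def)
      define x where "x = \<delta>' * cmod (c n) ^ Suc \<kappa>"
      have x: "x \<ge> 0" using \<delta>' by (simp add: x_def)
      show ?case
      proof
        fix z assume z: "z \<in> cball (0::complex) R"
        have "cmod (\<Sum>i<k. b n i * h i n z) \<le> (\<Sum>i<k. \<bar>B (k - i)\<bar> * x)"
        proof (rule sum_norm_le)
          fix i assume i: "i \<in> {..<k}"
          then have "cmod (b n i) \<le> \<bar>B (k - i)\<bar>"
            using B[of "k - i" n] elim(3) by (force simp: b_def)
          moreover have "cmod (h i n z) \<le> x"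
            using elim(1) i z by (simp add: x_def low)
          ultimately show "cmod (b n i * h i n z) \<le> \<bar>B (k - i)\<bar> * x"
            unfolding norm_mult by (intro mult_mono) auto
        qed
        also have "\<dots> = A * x" by (simp add: A_def sum_distrib_right)
        finally have "cmod (u n z - (\<Sum>i<k. b n i * h i n z)) \<le> x + A * x"
          using elim(2) z norm_triangle_ineq4[of "u n z" "\<Sum>i<k. b n i * h i n z"]
          by (force simp: x_def low)
        also have "\<dots> = (1 + A) * \<delta>' * cmod (c n) ^ Suc \<kappa>"
          by (simp add: x_def algebra_simps)
        also have "(1 + A) * \<delta>' = \<delta>" using A by (simp add: \<delta>'_def)
        finally have "inverse (cmod (c n)) * cmod (u n z - (\<Sum>i<k. b n i * h i n z))
            \<le> inverse (cmod (c n)) * (\<delta> * cmod (c n) ^ Suc \<kappa>)"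
          using c by (intro mult_left_mono) auto
        then show "cmod (H n z) \<le> \<delta> * low_coeff n ^ \<kappa>"
          using c by (simp add: H_def norm_mult norm_inverse norm_divide low field_simps)
      qed
    qed
  qed
  ultimately show ?case by blast
qed

lemma property_Q_imp_dense:
  assumes "property_Q P" "\<And>n. n \<ge> 1 \<Longrightarrow> P n \<noteq> 0" and q: "q \<in> entire_functions" and "\<epsilon> > 0"
  obtains g where "g \<in> solvable_targets P F" "\<And>z. z \<in> cball 0 R \<Longrightarrow> cmod (g z - q z) \<le> \<epsilon>"
proof -
  obtain J where J: "\<And>z. z \<in> cball 0 R \<Longrightarrow>
      cmod (q z - poly (poly_of_coeffs (taylor_coeff q) J) z) \<le> \<epsilon>"
    using taylor_polynomial_uniform[OF q \<open>\<epsilon> > 0\<close>] by metis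
  have "(\<lambda>z. z ^ k / fact k) \<in> solvable_targets P F" for k
  proof -
    obtain h where h: "\<And>n. h n \<in> entire_functions"
      "\<forall>\<^sub>F n in F. poly_D (P n) (h n) = (\<lambda>z. z ^ k / fact k)"
      "\<And>R \<kappa> \<delta>. \<delta> > 0 \<Longrightarrow> \<forall>\<^sub>F n in F. \<forall>z\<in>cball 0 R. cmod (h n z) \<le> \<delta> * low_coeff n ^ \<kappa>"
      using property_Q_preimages[OF assms(1,2), of k] by blast
    \<comment> \<open>The exponent 0 turns the strengthened bound back into plain smallness.\<close>
    show ?thesis
      unfolding solvable_targets_def using h(1,2) h(3)[where \<kappa> = 0]
      by (intro CollectI exI[of _ h]) auto
  qed
  then have "(\<lambda>z. \<Sum>j<J. (taylor_coeff q j * fact j) * (z ^ j / fact j)) \<in> solvable_targets P F"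
    by (intro solvable_targets_sum solvable_targets_cmult) auto
  moreover have "(\<lambda>z. \<Sum>j<J. (taylor_coeff q j * fact j) * (z ^ j / fact j)) =
      poly (poly_of_coeffs (taylor_coeff q) J)"
    by (auto simp: poly_of_coeffs_def poly_sum poly_monom)
  ultimately show thesis using J that by (simp add: norm_minus_commute)
qed

lemma property_P_imp_dense:
  assumes "property_P P" "F \<noteq> bot" and q: "q \<in> entire_functions" and "\<epsilon> > 0"
  obtains g where "g \<in> solvable_targets P F" "\<And>z. z \<in> cball 0 R \<Longrightarrow> cmod (g z - q z) \<le> \<epsilon>"
proof -
  obtain U where U: "unicity_set U"
    "\<And>w. w \<in> U \<Longrightarrow> filterlim (\<lambda>n. cmod (poly (P n) w)) at_top sequentially"
    using assms(1) by (auto simp: property_P_def)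
  show thesis
  proof (rule unicity_set_imp_dense[OF U(1) _ solvable_targets_zero solvable_targets_add
        solvable_targets_cmult _ q \<open>\<epsilon> > 0\<close>, where R = R])
    show "solvable_targets P F \<subseteq> entire_functions"
      using solvable_targets_entire[OF assms(2)] by blast
    show "(\<lambda>z. exp (w * z)) \<in> solvable_targets P F" if "w \<in> U" for w
      using filterlim_mono[OF U(2)[OF that] order_refl F] by (rule exp_in_solvable_targets)
  qed (assumption | rule that)+
qed

end

section \<open>Reduction of (R) to (P), and the common consequence of the three properties\<close>

lemma unicity_set_sphere:
  assumes "r > 0"
  shows "unicity_set (sphere 0 r)"
  unfolding unicity_set_def
proof (intro ballI impI allI)
  fix f z assume f: "f \<in> exponential_type" and 0: "\<forall>z\<in>sphere 0 r. f z = 0"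
  have "connected (sphere (0::complex) r)" by (rule connected_sphere) simp
  moreover have "of_real r \<in> sphere (0::complex) r" "- of_real r \<in> sphere (0::complex) r"
    using assms by auto
  moreover have "of_real r \<noteq> (- of_real r :: complex)" using assms by simp
  \<comment> \<open>A connected set with two points has no isolated point, so the zeros accumulate
    and the identity theorem applies.\<close>
  ultimately have "of_real r islimpt sphere (0::complex) r"
    by (metis connected_imp_perfect singletonD)
  then show "f z = 0"
    using f 0 by (intro analytic_continuation[of f UNIV "sphere 0 r" "of_real r" z])
      (auto simp: exponential_type_def)
qed

text \<open>The circle itself serves as unicity set: each value on it dominates the minimum over
  it.\<close>

lemma property_R_imp_property_P:
  assumes "property_R P"
  shows "property_P P"
proof -
  obtain r where r: "r > 0"
    "filterlim (\<lambda>n. INF z\<in>sphere 0 r. cmod (poly (P n) z)) at_top sequentially"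
    using assms by (auto simp: property_R_def)
  have "filterlim (\<lambda>n. cmod (poly (P n) z)) at_top sequentially" if "z \<in> sphere 0 r" for z
  proof (rule filterlim_at_top_mono[OF r(2)])
    have "(INF z\<in>sphere 0 r. cmod (poly (P n) z)) \<le> cmod (poly (P n) z)" for n
      by (rule cINF_lower[OF bdd_belowI[of _ 0] that]) auto
    then show "\<forall>\<^sub>F n in sequentially. (INF z\<in>sphere 0 r. cmod (poly (P n) z)) \<le> cmod (poly (P n) z)"
      by simp
  qed
  then show ?thesis
    using unicity_set_sphere[OF r(1)] by (auto simp: property_P_def)
qed

lemma approximate_preimages:
  fixes P :: "nat \<Rightarrow> complex poly"
  assumes nonconstant: "\<And>n. n \<ge> 1 \<Longrightarrow> degree (P n) > 0"
    and unbounded: "\<not> bdd_above ((\<lambda>n. valence (P n)) ` {1..})"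
    and PQR: "property_P P \<or> property_Q P \<or> property_R P"
    and q: "q \<in> entire_functions" and "\<delta> > 0" "\<epsilon> > 0"
  obtains n h where "n \<ge> 1" "valence (P n) > N" "h \<in> entire_functions"
    "\<And>z. z \<in> cball 0 R \<Longrightarrow> cmod (h z) \<le> \<delta>"
    "\<And>z. z \<in> cball 0 R \<Longrightarrow> cmod (poly_D (P n) h z - q z) \<le> \<epsilon>"
proof -
  \<comment> \<open>\<open>F\<close> acts as a subsequence along which the valences tend to
    infinity. It is nontrivial, since otherwise the valences would be bounded from some index on and
    hence bounded.\<close>
  define F where "F = inf sequentially (filtercomap (\<lambda>n. valence (P n)) at_top)"
  have F: "F \<le> sequentially" by (simp add: F_def)
  have val: "filterlim (\<lambda>n. valence (P n)) at_top F"
    unfolding F_def by (rule filterlim_mono[OF filterlim_filtercomap order_refl]) simp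
  have "F \<noteq> bot"
  proof
    assume "F = bot"
    then have "eventually (\<lambda>_. False) F" by simp
    then obtain n0 N where no: "\<And>n. n \<ge> n0 \<Longrightarrow> valence (P n) < N"
      unfolding F_def eventually_inf eventually_filtercomap eventually_at_top_linorder
      by (meson not_le)
    have "valence (P n) \<le> max N (Max ((\<lambda>n. valence (P n)) ` {..n0}))" for n
    proof (cases "n \<ge> n0")
      case True
      then show ?thesis using no[of n] by simp
    next
      case False
      then have "valence (P n) \<le> Max ((\<lambda>n. valence (P n)) ` {..n0})" by (intro Max_ge) auto
      then show ?thesis by simp
    qed
    then show False using unbounded by (meson bdd_above.I2)
  qed
  have nz: "P n \<noteq> 0" if "n \<ge> 1" for n using nonconstant[OF that] by auto
  obtain g where g: "g \<in> solvable_targets P F" "\<And>z. z \<in> cball 0 R \<Longrightarrow> cmod (g z - q z) \<le> \<epsilon>"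
    using PQR property_R_imp_property_P property_P_imp_dense[OF F val _ \<open>F \<noteq> bot\<close> q \<open>\<epsilon> > 0\<close>]
      property_Q_imp_dense[OF F val _ nz q \<open>\<epsilon> > 0\<close>] by metis
  then obtain h where h: "\<And>n. h n \<in> entire_functions" "\<forall>\<^sub>F n in F. poly_D (P n) (h n) = g"
    "\<forall>\<^sub>F n in F. \<forall>z\<in>cball 0 R. cmod (h n z) \<le> \<delta>"
    using \<open>\<delta> > 0\<close> unfolding solvable_targets_def by blast
  have "\<forall>\<^sub>F n in F. n \<ge> 1" using F by (rule filter_leD) (rule eventually_ge_at_top)
  moreover have "\<forall>\<^sub>F n in F. valence (P n) > N"
    using val[unfolded filterlim_at_top, rule_format, of "Suc N"] by eventually_elim simp
  ultimately have "\<forall>\<^sub>F n in F. n \<ge> 1 \<and> valence (P n) > N \<and> poly_D (P n) (h n) = g \<and>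
      (\<forall>z\<in>cball 0 R. cmod (h n z) \<le> \<delta>)"
    using h(2,3) by eventually_elim blast
  from eventually_happens'[OF \<open>F \<noteq> bot\<close> this] obtain n where
    "n \<ge> 1" "valence (P n) > N" "poly_D (P n) (h n) = g" "\<forall>z\<in>cball 0 R. cmod (h n z) \<le> \<delta>" by blast
  with h(1) g(2) that show thesis by metis
qed

subsection \<open>Construction of the blocks\<close>

text \<open>Here \<open>b\<close> is where the previous block ends and \<open>a\<close> where the
  new one ends. The weighted coefficient bound makes series assembled from the blocks entire; the
  last clause lets a tail starting at \<open>a\<close> absorb the size of the operator.\<close>

definition block_step ::
    "(nat \<Rightarrow> complex poly) \<Rightarrow> (complex \<Rightarrow> complex) \<Rightarrow> nat \<Rightarrow> nat \<Rightarrow> nat \<Rightarrow> complex poly \<Rightarrow> nat \<Rightarrow> bool" where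
  "block_step P q t b n p a \<longleftrightarrow> n \<ge> 1 \<and> b < valence (P n) \<and> b < a \<and>
     (\<forall>j<valence (P n). coeff p j = 0) \<and> (\<forall>j\<ge>a. coeff p j = 0) \<and>
     (\<forall>j. cmod (coeff p j) * (2 * (real t + 1)) ^ j \<le> 1) \<and>
     (\<forall>z\<in>cball 0 (real t). cmod (poly_D (P n) (poly p) z - q z) \<le> 1 / (real t + 1)) \<and>
     poly_D_bound (P n) \<le> 2 ^ a"

lemma poly_D_bound_nonneg: "poly_D_bound p \<ge> 0"
  by (simp add: poly_D_bound_def sum_nonneg)

lemma ex_block_step:
  fixes P :: "nat \<Rightarrow> complex poly"
  assumes "\<And>n. n \<ge> 1 \<Longrightarrow> degree (P n) > 0"
    and "\<not> bdd_above ((\<lambda>n. valence (P n)) ` {1..})"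
    and "property_P P \<or> property_Q P \<or> property_R P"
    and q: "q \<in> entire_functions"
  shows "\<exists>n p a. block_step P q t b n p a"
proof -
  \<comment> \<open>One half of the tolerance goes to the approximate preimage, the other to its
    truncation.\<close>
  define \<epsilon> where "\<epsilon> = 1 / (real t + 1) / 2"
  have \<epsilon>: "\<epsilon> > 0" "2 * \<epsilon> = 1 / (real t + 1)"
    by (simp add: \<epsilon>_def, simp only: \<epsilon>_def mult_2 field_sum_of_halves)
  \<comment> \<open>On radius \<open>2 * (real t + 1)\<close> the bound 1 yields the weighted
    coefficient bound of the block by the Cauchy estimate.\<close>
  obtain n h where n: "n \<ge> 1" "valence (P n) > b" and h: "h \<in> entire_functions"
    and h_le: "\<And>z. z \<in> cball 0 (2 * (real t + 1)) \<Longrightarrow> cmod (h z) \<le> 1"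
    and Th: "\<And>z. z \<in> cball 0 (2 * (real t + 1)) \<Longrightarrow> cmod (poly_D (P n) h z - q z) \<le> \<epsilon>"
    using approximate_preimages[OF assms zero_less_one \<epsilon>(1), of b "2 * (real t + 1)"] by metis
  define m K where "m = valence (P n)" and "K = poly_D_bound (P n)"
  have K: "K \<ge> 0" by (simp add: K_def poly_D_bound_nonneg)
  then have "\<epsilon> / (K + 1) > 0" using \<epsilon> by (simp add: add_nonneg_pos)
  \<comment> \<open>Applying the operator costs one unit of radius and a factor \<open>K\<close>;
    dividing by \<open>K + 1\<close> also covers \<open>K = 0\<close>.\<close>
  then obtain J where J: "\<And>z. z \<in> cball 0 (real t + 1) \<Longrightarrow>
      cmod (h z - poly (poly_of_coeffs (taylor_coeff h) J) z) \<le> \<epsilon> / (K + 1)"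
    using taylor_polynomial_uniform[OF h] by metis
  define p0 where "p0 = poly_of_coeffs (taylor_coeff h) J"
  define p where "p = poly_of_coeffs (\<lambda>j. if j < m then 0 else taylor_coeff h j) J"
  have "poly_D (P n) (\<lambda>z. poly p0 z - poly p z) = (\<lambda>z. 0)"
    by (rule poly_D_eq_0[where m = m])
      (auto simp: entire_diff entire_poly taylor_coeff_diff taylor_coeff_poly p0_def p_def
        coeff_poly_of_coeffs m_def coeff_less_valence)
  then have Tp: "poly_D (P n) (poly p) z = poly_D (P n) (poly p0) z" for z
    by (simp add: poly_D_diff entire_poly fun_eq_iff)
  have "cmod (poly_D (P n) (poly p) z - q z) \<le> 1 / (real t + 1)" if z: "z \<in> cball 0 (real t)" for z
  proof -
    have "cmod (poly_D (P n) (\<lambda>z. h z - poly p0 z) z) \<le> K * (\<epsilon> / (K + 1))"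
      unfolding K_def
      by (rule norm_poly_D_le[where R = "real t"])
        (use z J in \<open>auto simp: p0_def K_def intro!: entire_diff h entire_poly\<close>)
    also have "\<dots> = \<epsilon> * (K / (K + 1))" by simp
    also have "\<dots> \<le> \<epsilon> * 1"
      using \<epsilon> K by (intro mult_left_mono) (auto simp: divide_le_eq_1_pos)
    finally have "cmod (poly_D (P n) h z - poly_D (P n) (poly p) z) \<le> \<epsilon>"
      by (simp add: poly_D_diff h entire_poly Tp)
    moreover have "cmod (poly_D (P n) h z - q z) \<le> \<epsilon>"
      using z by (intro Th) auto
    ultimately have "cmod (poly_D (P n) (poly p) z - q z) \<le> 2 * \<epsilon>"
      using norm_triangle_ineq4[of "poly_D (P n) h z - q z" "poly_D (P n) h z - poly_D (P n) (poly p) z"]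
      by simp
    then show ?thesis using \<epsilon> by simp
  qed
  moreover have "cmod (coeff p j) * (2 * (real t + 1)) ^ j \<le> 1" for j
    using norm_taylor_coeff_le[OF h _ h_le, where j = j] by (simp add: p_def coeff_poly_of_coeffs)
  moreover obtain N where "K < 2 ^ N" using real_arch_pow[of 2 K] by auto
  then have "K \<le> 2 ^ max (max (Suc b) J) N"
    by (intro order_trans[OF less_imp_le power_increasing]) auto
  moreover have "\<forall>j<m. coeff p j = 0" "\<forall>j\<ge>max (max (Suc b) J) N. coeff p j = 0"
    by (auto simp: p_def coeff_poly_of_coeffs)
  \<comment> \<open>The new end must lie beyond \<open>b\<close>, beyond the support of
    \<open>p\<close> (by \<open>J\<close>), and far enough for \<open>2 ^ a\<close> to exceed
    \<open>K\<close> (by \<open>N\<close>).\<close>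
  ultimately have "block_step P q t b n p (max (max (Suc b) J) N)"
    using n by (auto simp: block_step_def m_def K_def)
  then show ?thesis by blast
qed

lemma ex_block_sequence:
  assumes "\<And>t b. \<exists>n p a. block_step P (q t) t b n p a"
  obtains a \<nu> p where "a 0 = 0" "\<And>t. block_step P (q t) t (a t) (\<nu> t) (p t) (a (Suc t))"
proof -
  \<comment> \<open>The operator, polynomial and end position of stage \<open>t\<close> are stored
    in \<open>f (Suc t)\<close>, while \<open>f t\<close> supplies its starting position. Hence only
    the last component of \<open>f 0\<close> is prescribed.\<close>
  have "\<exists>f. \<forall>t. (t = 0 \<longrightarrow> snd (snd (f t)) = 0) \<and>
      block_step P (q t) t (snd (snd (f t))) (fst (f (Suc t))) (fst (snd (f (Suc t)))) (snd (snd (f (Suc t))))"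
    by (rule dependent_nat_choice) (use assms in auto)
  then obtain f where "\<And>t. (t = 0 \<longrightarrow> snd (snd (f t)) = 0) \<and>
      block_step P (q t) t (snd (snd (f t))) (fst (f (Suc t))) (fst (snd (f (Suc t)))) (snd (snd (f (Suc t))))"
    by blast
  then show thesis
    by (intro that[of "\<lambda>t. snd (snd (f t))" "\<lambda>t. fst (f (Suc t))" "\<lambda>t. fst (snd (f (Suc t)))"]) auto
qed

section \<open>A recurrent dense sequence of polynomial targets\<close>

lemma ex_rational_complex_near:
  assumes "\<eta> > 0"
  shows "\<exists>x y. cmod (Complex (of_rat x) (of_rat y) - c) \<le> \<eta>"
proof -
  obtain x where "Re c < of_rat x" "of_rat x < Re c + \<eta> / 2"
    using of_rat_dense[of "Re c" "Re c + \<eta> / 2"] assms by auto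
  moreover obtain y where "Im c < of_rat y" "of_rat y < Im c + \<eta> / 2"
    using of_rat_dense[of "Im c" "Im c + \<eta> / 2"] assms by auto
  ultimately have "cmod (Complex (of_rat x) (of_rat y) - c) \<le> \<eta>"
    using cmod_le[of "Complex (of_rat x) (of_rat y) - c"] by simp
  then show ?thesis by blast
qed

text \<open>Which free coefficient of a member of the subspace is nonzero depends on the member, and
  the errors are small only at late stages. So every index \<open>k\<close> must meet approximations
  of every target arbitrarily late.\<close>

lemma ex_recurrent_dense_targets:
  shows "\<exists>(i :: nat \<Rightarrow> nat) (q :: nat \<Rightarrow> complex poly). \<forall>k G R \<epsilon> T.
    G \<in> entire_functions \<longrightarrow> \<epsilon> > 0 \<longrightarrow>
      (\<exists>t\<ge>T. i t = k \<and> (\<forall>z\<in>cball 0 R. cmod (poly (q t) z - G z) \<le> \<epsilon>))"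
proof -
  \<comment> \<open>A task is an index, a list of rational coefficient pairs, and a dummy number;
    varying the dummy gives infinitely many codes for the same index and polynomial.\<close>
  define task :: "nat \<Rightarrow> nat \<times> (rat \<times> rat) list \<times> nat" where "task = from_nat"
  define qq where "qq l = Poly (map (\<lambda>(x, y). Complex (of_rat x) (of_rat y)) l)" for l
  have "\<exists>t\<ge>T. fst (task t) = k \<and>
      (\<forall>z\<in>cball 0 R. cmod (poly (qq (fst (snd (task t)))) z - G z) \<le> \<epsilon>)"
    if G: "G \<in> entire_functions" and "\<epsilon> > 0" for k G R \<epsilon> T
  proof -
    define r where "r = max R 0"
    obtain J where J: "\<And>z. z \<in> cball 0 R \<Longrightarrow>
        cmod (G z - poly (poly_of_coeffs (taylor_coeff G) J) z) \<le> \<epsilon> / 2"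
      using taylor_polynomial_uniform[OF G, of "\<epsilon> / 2"] \<open>\<epsilon> > 0\<close> by (metis half_gt_zero)
    define S where "S = (\<Sum>j<J. r ^ j)"
    \<comment> \<open>Half of \<open>\<epsilon>\<close> pays for the Taylor remainder; the other
      half is distributed over the coefficients, whose rounding errors are amplified by at most
      \<open>S\<close>.\<close>
    define \<eta> where "\<eta> = \<epsilon> / 2 / (S + 1)"
    have S: "S \<ge> 0" by (simp add: S_def sum_nonneg r_def)
    then have "\<eta> > 0" using \<open>\<epsilon> > 0\<close> by (simp add: \<eta>_def)
    then have "\<exists>x y. cmod (Complex (of_rat x) (of_rat y) - taylor_coeff G j) \<le> \<eta>" for j
      by (rule ex_rational_complex_near)
    then obtain x y where xy: "\<And>j. cmod (Complex (of_rat (x j)) (of_rat (y j)) - taylor_coeff G j) \<le> \<eta>"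
      by metis
    define b where "b j = Complex (of_rat (x j)) (of_rat (y j))" for j
    define l where "l = map (\<lambda>j. (x j, y j)) [0..<J]"
    have ql: "qq l = poly_of_coeffs b J"
      by (rule poly_eqI) (simp add: qq_def l_def coeff_poly_of_coeffs nth_default_def b_def)
    have close: "cmod (poly (qq l) z - G z) \<le> \<epsilon>" if z: "z \<in> cball 0 R" for z
    proof -
      have "poly (qq l) z - poly (poly_of_coeffs (taylor_coeff G) J) z =
          (\<Sum>j<J. (b j - taylor_coeff G j) * z ^ j)"
        unfolding ql by (simp add: poly_of_coeffs_def poly_sum poly_monom sum_subtractf algebra_simps)
      also have "cmod \<dots> \<le> (\<Sum>j<J. \<eta> * r ^ j)"
        using xy z \<open>\<eta> > 0\<close>
        by (intro sum_norm_le) (auto simp: norm_mult norm_power b_def r_def intro!: mult_mono power_mono)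
      also have "\<dots> = \<eta> * S" by (simp only: S_def sum_distrib_left)
      also have "\<dots> = \<epsilon> / 2 * (S / (S + 1))" by (simp add: \<eta>_def)
      also have "\<dots> \<le> \<epsilon> / 2 * 1"
        using \<open>\<epsilon> > 0\<close> S by (intro mult_left_mono) (auto simp: divide_le_eq_1_pos)
      finally show ?thesis
        using J[OF z] norm_triangle_ineq4[of "poly (qq l) z - poly (poly_of_coeffs (taylor_coeff G) J) z"
            "G z - poly (poly_of_coeffs (taylor_coeff G) J) z"] by simp
    qed
    have "inj (\<lambda>s. to_nat (k, l, s :: nat))" by (auto intro: injI)
    then have "infinite (range (\<lambda>s. to_nat (k, l, s :: nat)))" using finite_imageD by blast
    then obtain s where "to_nat (k, l, s :: nat) \<ge> T"
      unfolding infinite_nat_iff_unbounded_le by blast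
    then show ?thesis
      using close by (intro exI[of _ "to_nat (k, l, s)"]) (simp add: task_def)
  qed
  then show ?thesis
    by (intro exI[of _ "\<lambda>t. fst (task t)"] exI[of _ "\<lambda>t. qq (fst (snd (task t)))"]) blast
qed

subsection \<open>The subspace\<close>

text \<open>The coefficients at \<open>a 1\<close>, \<open>a 2\<close>, and so on lie in none of the
  open intervals and stay free; the one at \<open>i t\<close> steers block \<open>t\<close>, even
  when \<open>i t\<close> exceeds \<open>t\<close>. Position 0, which is \<open>a 0\<close> in the
  application, is set to zero.\<close>

definition block_space ::
    "(nat \<Rightarrow> nat) \<Rightarrow> (nat \<Rightarrow> complex poly) \<Rightarrow> (nat \<Rightarrow> nat) \<Rightarrow> (complex \<Rightarrow> complex) set" where
  "block_space a p i = {f \<in> entire_functions. taylor_coeff f 0 = 0 \<and>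
     (\<forall>t. \<forall>j\<in>{a t<..<a (Suc t)}. taylor_coeff f j = coeff (p t) j * taylor_coeff f (a (Suc (i t))))}"

lemma entire_zero: "0 \<in> entire_functions"
  by (simp add: zero_fun_def entire_functions_def)

lemma taylor_coeff_zero: "taylor_coeff 0 j = 0"
  by (simp add: zero_fun_def taylor_coeff_def)

lemma subspace_block_space: "module.subspace fun_scale (block_space a p i)"
proof -
  interpret vector_space fun_scale by (rule vector_space_fun_scale)
  show ?thesis
  proof (rule subspaceI)
    show "0 \<in> block_space a p i" by (simp add: block_space_def entire_zero taylor_coeff_zero)
    show "f + g \<in> block_space a p i" if "f \<in> block_space a p i" "g \<in> block_space a p i" for f g
      using that by (simp add: block_space_def plus_fun_def entire_add taylor_coeff_add distrib_left)
    show "fun_scale c f \<in> block_space a p i" if "f \<in> block_space a p i" for f c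
      using that by (simp add: block_space_def fun_scale_def entire_cmult taylor_coeff_cmult mult.left_commute)
  qed
qed

text \<open>By the Cauchy estimate on the unit disc, each Taylor coefficient is a continuous
  functional.\<close>

lemma closedin_taylor_relation:
  "closedin entire_topology {f \<in> entire_functions. taylor_coeff f u = w * taylor_coeff f v}"
    (is "closedin _ ?S")
proof -
  have "\<exists>K e. compact K \<and> e > 0 \<and>
      {g \<in> entire_functions. \<forall>z\<in>K. dist (g z) (f z) < e} \<subseteq> entire_functions - ?S"
    if f: "f \<in> entire_functions" "f \<notin> ?S" for f
  proof (intro exI conjI)
    define \<Delta> where "\<Delta> g = taylor_coeff g u - w * taylor_coeff g v" for g
    \<comment> \<open>A perturbation of size \<open>e\<close> on the unit disc moves
      \<open>\<Delta>\<close> by at most \<open>e * (1 + cmod w)\<close>, which is half of its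
      modulus at \<open>f\<close>.\<close>
    define e where "e = cmod (\<Delta> f) / 2 / (1 + cmod w)"
    have "cmod (\<Delta> f) > 0" using f by (simp add: \<Delta>_def)
    moreover have w: "1 + cmod w > 0" by (simp add: add_pos_nonneg)
    ultimately show "e > 0" by (simp add: e_def)
    have e: "e * (1 + cmod w) = cmod (\<Delta> f) / 2"
      using w nonzero_eq_divide_eq[of "1 + cmod w" e "cmod (\<Delta> f) / 2"] by (simp only: e_def) force
    show "compact (cball (0::complex) 1)" by simp
    show "{g \<in> entire_functions. \<forall>z\<in>cball 0 1. dist (g z) (f z) < e} \<subseteq> entire_functions - ?S"
    proof clarify
      fix g assume g: "g \<in> entire_functions" "\<forall>z\<in>cball 0 1. dist (g z) (f z) < e"
        and "taylor_coeff g u = w * taylor_coeff g v"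
      then have "\<Delta> g = 0" by (simp add: \<Delta>_def)
      have d: "cmod (taylor_coeff (\<lambda>z. g z - f z) j) \<le> e" for j
        using norm_taylor_coeff_le[OF entire_diff[OF g(1) f(1)], of 1 e j] g(2)
        by (simp add: dist_norm less_imp_le)
      have "cmod (\<Delta> f) = cmod (\<Delta> g - \<Delta> f)" by (simp add: \<open>\<Delta> g = 0\<close>)
      also have "\<Delta> g - \<Delta> f = taylor_coeff (\<lambda>z. g z - f z) u - w * taylor_coeff (\<lambda>z. g z - f z) v"
        using f g by (simp add: \<Delta>_def taylor_coeff_diff algebra_simps)
      also have "cmod \<dots> \<le> e + cmod w * e"
        by (rule order_trans[OF norm_triangle_ineq4])
          (auto simp: norm_mult intro!: add_mono mult_left_mono d)
      also have "\<dots> = cmod (\<Delta> f) / 2" using e by (simp add: algebra_simps)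
      finally show False using \<open>cmod (\<Delta> f) > 0\<close> by simp
    qed
  qed
  then show ?thesis
    by (auto simp: closedin_def openin_entire_topology)
qed

lemma closedin_block_space: "closedin entire_topology (block_space a p i)"
proof -
  define S where "S u w v = {f \<in> entire_functions. taylor_coeff f u = w * taylor_coeff f v}" for u w v
  have S: "closedin entire_topology (S u w v)" for u w v
    unfolding S_def by (rule closedin_taylor_relation)
  \<comment> \<open>\<open>S 0 0 0\<close> encodes the vanishing constant term and keeps the family
    nonempty.\<close>
  define \<F> where "\<F> = insert (S 0 0 0)
    ((\<lambda>(t, j). S j (coeff (p t) j) (a (Suc (i t)))) ` (SIGMA t:UNIV. {a t<..<a (Suc t)}))"
  have "block_space a p i = \<Inter>\<F>"
    by (auto simp: block_space_def \<F>_def S_def)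
  moreover have "closedin entire_topology (\<Inter>\<F>)"
    by (rule closedin_Inter) (auto simp: \<F>_def S)
  ultimately show ?thesis by simp
qed

section \<open>Block positions, dimension of the subspace, and approximation by its members\<close>

context
  fixes a :: "nat \<Rightarrow> nat"
  assumes a0: "a 0 = 0" and a_Suc: "\<And>t. a t < a (Suc t)"
begin

text \<open>Block \<open>t\<close> is the interval \<open>{a t<..a (Suc t)}\<close>, closed on the
  right so that it contains its free position; these intervals partition the positive integers. At 0
  the value is the default 0.\<close>

definition block_index :: "nat \<Rightarrow> nat" where
  "block_index j = (LEAST t. j \<le> a (Suc t))"

lemma block_strict_mono: "strict_mono a"
  using a_Suc by (rule strict_mono_Suc_iff[THEN iffD2, rule_format])

lemma le_block_Suc: "t \<le> a (Suc t)"
  using strict_mono_imp_increasing[OF block_strict_mono, of "Suc t"] by simp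

lemma block_index_bounds:
  assumes "j > 0"
  shows "a (block_index j) < j" "j \<le> a (Suc (block_index j))"
proof -
  show 1: "j \<le> a (Suc (block_index j))"
    unfolding block_index_def by (rule LeastI[of _ j]) (rule le_block_Suc)
  show "a (block_index j) < j"
  proof (cases "block_index j")
    case 0
    then show ?thesis using a0 assms by simp
  next
    case (Suc t)
    then have "\<not> j \<le> a (Suc t)"
      using not_less_Least[of t "\<lambda>t. j \<le> a (Suc t)"] by (simp add: block_index_def)
    then show ?thesis using Suc by simp
  qed
qed

lemma block_index_eq:
  assumes "a t < j" "j \<le> a (Suc t)"
  shows "block_index j = t"
proof (rule antisym)
  show "block_index j \<le> t" unfolding block_index_def using assms(2) by (rule Least_le)
  have "a t < a (Suc (block_index j))"
    using block_index_bounds[of j] assms by simp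
  then show "t \<le> block_index j" using block_strict_mono by (simp add: strict_mono_less)
qed

text \<open>Inside the blocks every coefficient is a multiple of a free one, and the constant term
  is 0, so the free coefficients determine the function.\<close>

lemma block_space_nonzero:
  assumes "f \<in> block_space a p i" "f \<noteq> 0"
  obtains s where "taylor_coeff f (a (Suc s)) \<noteq> 0"
proof (rule ccontr)
  assume "\<not> thesis"
  then have z: "taylor_coeff f (a (Suc s)) = 0" for s using that by blast
  have "taylor_coeff f j = 0" for j
  proof (cases "j = 0 \<or> j = a (Suc (block_index j))")
    case True
    then show ?thesis
    proof
      assume "j = 0"
      then show ?thesis using assms(1) by (simp add: block_space_def)
    next
      assume j: "j = a (Suc (block_index j))"
      show ?thesis by (subst j) (rule z)
    qed
  next
    case False
    then have "j \<in> {a (block_index j)<..<a (Suc (block_index j))}"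
      using block_index_bounds[of j] by auto
    then show ?thesis using assms(1) z by (simp add: block_space_def)
  qed
  then have "f = 0"
    using assms(1) by (intro entire_eqI entire_zero) (auto simp: block_space_def taylor_coeff_zero)
  then show False using assms(2) by blast
qed

text \<open>The decay of the block coefficients makes the prescribed series converge everywhere. The
  functions obtained form the infinite independent family used for the dimension.\<close>

lemma block_space_basis:
  assumes p: "\<And>t j. cmod (coeff (p t) j) * (2 * (real t + 1)) ^ j \<le> 1"
  obtains f where "f \<in> block_space a p i"
    "\<And>s. taylor_coeff f (a (Suc s)) = (if s = k then 1 else 0)"
proof -
  \<comment> \<open>Once the free coefficients are prescribed, the defining relations leave no other
    choice.\<close>
  define v where "v j = (if j = 0 then 0
    else if j = a (Suc (block_index j)) then (if block_index j = k then 1 else 0)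
    else if i (block_index j) = k then coeff (p (block_index j)) j else 0)" for j
  have v_a: "v (a (Suc s)) = (if s = k then 1 else 0)" for s
    using block_index_eq[of s "a (Suc s)"] a_Suc[of s] by (simp add: v_def)
  have "summable (\<lambda>j. v j * z ^ j)" for z
  proof (rule summable_comparison_test'[OF summable_geometric[of "1/2::real"]])
    \<comment> \<open>Past block \<open>k\<close> the lone free coefficient 1 no longer occurs; past
      the modulus of \<open>z\<close>, the weight \<open>2 * (t + 1)\<close> is at least twice that
      modulus.\<close>
    define T where "T = max k (nat \<lceil>cmod z\<rceil>)"
    fix j assume "j \<ge> Suc (a (Suc T))"
    then have j: "j > 0" "block_index j > T"
      using block_index_bounds[of j] strict_mono_less[OF block_strict_mono, of "Suc T" "Suc (block_index j)"]
      by auto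
    let ?t = "real (block_index j) + 1"
    have "nat \<lceil>cmod z\<rceil> \<le> T" unfolding T_def by (rule max.cobounded2)
    then have "real (nat \<lceil>cmod z\<rceil>) \<le> ?t" using j(2) by linarith
    then have t: "cmod z \<le> ?t" using real_nat_ceiling_ge by (rule order_trans[rotated])
    have "cmod (v j) \<le> cmod (coeff (p (block_index j)) j)"
      using j by (auto simp: v_def T_def)
    then have "cmod (v j) * cmod z ^ j \<le> cmod (coeff (p (block_index j)) j) * ?t ^ j"
      using t by (intro mult_mono power_mono) auto
    also have "\<dots> = cmod (coeff (p (block_index j)) j) * (2 * ?t) ^ j / 2 ^ j"
      by (simp only: power_mult_distrib) simp
    also have "\<dots> \<le> 1 / 2 ^ j"
      by (intro divide_right_mono p) simp
    also have "\<dots> = (1/2) ^ j" by (simp add: power_one_over)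
    finally show "norm (v j * z ^ j) \<le> (1/2) ^ j"
      by (simp add: norm_mult norm_power)
  qed simp
  then have sums: "(\<lambda>j. v j * z ^ j) sums (\<Sum>j. v j * z ^ j)" for z by (rule summable_sums)
  define f where "f z = (\<Sum>j. v j * z ^ j)" for z
  have f: "f \<in> entire_functions" "taylor_coeff f j = v j" for j
    using taylor_coeff_eqI[of v f] sums by (simp_all add: f_def)
  show thesis
  proof
    have "v j = coeff (p t) j * v (a (Suc (i t)))" if "j \<in> {a t<..<a (Suc t)}" for t j
    proof -
      have "block_index j = t" using that by (intro block_index_eq) auto
      then show ?thesis using that v_a[of "i t"] by (simp add: v_def)
    qed
    then show "f \<in> block_space a p i" by (simp add: block_space_def f v_def)
    show "taylor_coeff f (a (Suc s)) = (if s = k then 1 else 0)" for s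
      by (simp add: f v_a)
  qed
qed

text \<open>The coefficient at \<open>a (Suc k)\<close> isolates the k-th scalar in a linear
  combination of the functions with unit free coefficients. These are therefore independent, and
  infinitely many cannot lie in the span of a finite set.\<close>

lemma block_space_not_finite_dim:
  assumes p: "\<And>t j. cmod (coeff (p t) j) * (2 * (real t + 1)) ^ j \<le> 1"
  shows "\<nexists>B. finite B \<and> module.span fun_scale B = block_space a p i"
proof
  interpret vector_space fun_scale by (rule vector_space_fun_scale)
  assume "\<exists>B. finite B \<and> span B = block_space a p i"
  then obtain B where B: "finite B" "span B = block_space a p i" by blast
  have "\<exists>f. f \<in> block_space a p i \<and>
      (\<forall>s. taylor_coeff f (a (Suc s)) = (if s = k then 1 else 0))" for k
    using block_space_basis[OF p, where i = i and k = k] by blast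
  then obtain f where f: "\<And>k. f k \<in> block_space a p i"
    "\<And>k s. taylor_coeff (f k) (a (Suc s)) = (if s = k then 1 else 0)"
    by metis
  have "inj f"
    by (rule injI) (metis f(2) zero_neq_one)
  have coeff_sum: "(\<Sum>v\<in>S. fun_scale (u v) v) \<in> entire_functions \<and>
      taylor_coeff (\<Sum>v\<in>S. fun_scale (u v) v) j = (\<Sum>v\<in>S. u v * taylor_coeff v j)"
    if "finite S" "S \<subseteq> entire_functions" for S u j
    using that
  proof (induction S rule: finite_induct)
    case empty
    show ?case using entire_zero taylor_coeff_zero by (simp add: zero_fun_def)
  next
    case (insert x S)
    then show ?case
      by (simp add: plus_fun_def fun_scale_def entire_add entire_cmult taylor_coeff_add taylor_coeff_cmult)
  qed
  have "independent (range f)"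
    unfolding independent_explicit_finite_subsets
  proof (intro allI impI ballI)
    fix S u v assume S: "S \<subseteq> range f" "finite S" "(\<Sum>v\<in>S. fun_scale (u v) v) = 0" "v \<in> S"
    then obtain k where k: "v = f k" by blast
    have "S \<subseteq> entire_functions" using S(1) f(1) by (auto simp: block_space_def)
    then have "taylor_coeff 0 (a (Suc k)) = (\<Sum>w\<in>S. u w * taylor_coeff w (a (Suc k)))"
      using coeff_sum[OF S(2), of u "a (Suc k)"] S(3) by simp
    also have "\<dots> = (\<Sum>w\<in>S. if w = v then u w else 0)"
    proof (rule sum.cong)
      fix w assume "w \<in> S"
      then obtain l where "w = f l" using S(1) by blast
      then show "u w * taylor_coeff w (a (Suc k)) = (if w = v then u w else 0)"
        using k f(2)[of l k] \<open>inj f\<close> by (auto simp: inj_eq)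
    qed simp
    also have "\<dots> = u v" using S by simp
    also have "taylor_coeff 0 (a (Suc k)) = 0"
      by (rule taylor_coeff_zero)
    finally show "u v = 0" by simp
  qed
  moreover have "range f \<subseteq> span B" using f(1) B(2) by auto
  ultimately have "finite (range f)" using independent_span_bound[OF B(1)] by blast
  then show False using \<open>inj f\<close> finite_imageD by blast
qed

text \<open>On \<open>f\<close> in the block space, \<open>P (\<nu> t)\<close> kills everything below block \<open>t\<close>, maps the block
  close to a multiple of \<open>q t\<close>, and \<open>a (Suc t)\<close> is so large that the rest is negligible.\<close>

lemma block_space_approx:
  assumes step: "\<And>t. block_step P (poly (q t)) t (a t) (\<nu> t) (p t) (a (Suc t))"
    and targets: "\<And>k G R \<epsilon> T. G \<in> entire_functions \<Longrightarrow> \<epsilon> > 0 \<Longrightarrow>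
      \<exists>t\<ge>T. i t = k \<and> (\<forall>z\<in>cball 0 R. cmod (poly (q t) z - G z) \<le> \<epsilon>)"
    and f: "f \<in> block_space a p i" "f \<noteq> 0" and G: "G \<in> entire_functions" and "\<epsilon> > 0"
  obtains n where "n \<ge> 1" "\<And>z. z \<in> cball 0 R \<Longrightarrow> cmod (poly_D (P n) f z - G z) < \<epsilon>"
proof -
  have fe: "f \<in> entire_functions" using f by (simp add: block_space_def)
  obtain k where k: "taylor_coeff f (a (Suc k)) \<noteq> 0" using block_space_nonzero[OF f] .
  define c where "c = taylor_coeff f (a (Suc k))"
  have c: "cmod c > 0" using k by (simp add: c_def)
  define r where "r = max R 1"
  have r: "r \<ge> R" "r \<ge> 1" by (auto simp: r_def)
  \<comment> \<open>Radius \<open>4 * (r + 1)\<close> gives the tail coefficients the decay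
    \<open>1 / 4 ^ j\<close> relative to radius \<open>r + 1\<close>. One factor
    \<open>1 / 2 ^ j\<close> feeds the geometric series; in all the tail is at most
    \<open>2 * C / 4 ^ A\<close>, of which one \<open>2 ^ A\<close> pays for the operator.\<close>
  obtain C where C: "C > 0" "\<And>z. z \<in> cball 0 (4 * (r + 1)) \<Longrightarrow> cmod (f z) \<le> C"
    using entire_bounded_cball[OF fe] by metis
  have "(\<lambda>t. 2 * C / 2 ^ t) \<longlonglongrightarrow> 0" by (rule LIMSEQ_divide_realpow_zero) simp
  then have ev1: "\<forall>\<^sub>F t in sequentially. 2 * C / 2 ^ t < \<epsilon> / 4"
    using \<open>\<epsilon> > 0\<close> by (intro order_tendstoD) auto
  have "(\<lambda>t. cmod c * inverse (real (Suc t))) \<longlonglongrightarrow> cmod c * 0"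
    by (intro tendsto_mult tendsto_const LIMSEQ_inverse_real_of_nat)
  then have ev2: "\<forall>\<^sub>F t in sequentially. cmod c * inverse (real (Suc t)) < \<epsilon> / 4"
    using \<open>\<epsilon> > 0\<close> by (intro order_tendstoD) auto
  have ev3: "\<forall>\<^sub>F t in sequentially. t \<ge> nat \<lceil>r\<rceil>" by (rule eventually_ge_at_top)
  from eventually_conj[OF ev1 eventually_conj[OF ev2 ev3]] obtain T where
    T: "\<And>t. t \<ge> T \<Longrightarrow> 2 * C / 2 ^ t < \<epsilon> / 4"
      "\<And>t. t \<ge> T \<Longrightarrow> cmod c * inverse (real (Suc t)) < \<epsilon> / 4"
      "\<And>t. t \<ge> T \<Longrightarrow> nat \<lceil>r\<rceil> \<le> t"
    unfolding eventually_sequentially by blast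
  have "(\<lambda>z. inverse c * G z) \<in> entire_functions" using G by (rule entire_cmult)
  moreover have "\<epsilon> / 4 / cmod c > 0" using \<open>\<epsilon> > 0\<close> c by simp
  \<comment> \<open>Stage \<open>t\<close> sends \<open>f\<close> close to \<open>c\<close> times
    its target, so the target should approximate \<open>G\<close> divided by \<open>c\<close>, with
    the accuracy divided by the modulus of \<open>c\<close>.\<close>
  ultimately obtain t where t: "t \<ge> T" "i t = k"
    "\<And>z. z \<in> cball 0 R \<Longrightarrow> cmod (poly (q t) z - inverse c * G z) \<le> \<epsilon> / 4 / cmod c"
    using targets[where G = "\<lambda>z. inverse c * G z" and k = k and T = T and R = R] by blast
  define n A m where "n = \<nu> t" and "A = a (Suc t)" and "m = valence (P n)"
  note S = step[of t, unfolded block_step_def, folded n_def A_def, folded m_def]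
  \<comment> \<open>Splits \<open>f\<close> into \<open>low\<close>, killed by the valence, the
    block \<open>c * p t\<close>, and a tail beginning at \<open>A\<close>. The part of block
    \<open>t\<close> below the valence belongs to \<open>low\<close>, where \<open>p t\<close> has
    no terms.\<close>
  define low where "low = poly_of_coeffs (taylor_coeff f) m"
  define tail where "tail = (\<lambda>z. (f z - c * poly (p t) z) - poly low z)"
  have tail_entire: "tail \<in> entire_functions"
    unfolding tail_def by (intro entire_diff fe entire_cmult entire_poly)
  have tail_coeff: "taylor_coeff tail j = taylor_coeff f j - c * coeff (p t) j - coeff low j" for j
    unfolding tail_def
    by (simp add: taylor_coeff_diff taylor_coeff_cmult taylor_coeff_poly fe entire_diff entire_cmult entire_poly)
  have tail_low: "taylor_coeff tail j = 0" if "j < A" for j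
  proof (cases "j < m")
    case True
    then show ?thesis using S by (simp add: tail_coeff low_def coeff_poly_of_coeffs)
  next
    case False
    then have "j \<in> {a t<..<a (Suc t)}" using S that by (auto simp: A_def)
    then have "taylor_coeff f j = coeff (p t) j * c"
      using f(1) t(2) by (auto simp: block_space_def c_def)
    then show ?thesis using False by (simp add: tail_coeff low_def coeff_poly_of_coeffs)
  qed
  have tail_high: "cmod (taylor_coeff tail j) * (r + 1) ^ j \<le> C / 2 ^ A / 2 ^ j" if "j \<ge> A" for j
  proof -
    have "coeff (p t) j = 0" using S that by blast
    then have "cmod (taylor_coeff tail j) \<le> cmod (taylor_coeff f j)"
      by (simp add: tail_coeff low_def coeff_poly_of_coeffs)
    then have "cmod (taylor_coeff tail j) * (r + 1) ^ j \<le> cmod (taylor_coeff f j) * (r + 1) ^ j"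
      using r by (intro mult_right_mono) auto
    also have "\<dots> \<le> C / 4 ^ j"
    proof -
      have "cmod (taylor_coeff f j) * (4 * (r + 1)) ^ j \<le> C"
        by (rule norm_taylor_coeff_le[OF fe _ C(2)]) (use r in auto)
      then show ?thesis
        by (simp only: power_mult_distrib) (simp add: pos_le_divide_eq mult_ac)
    qed
    also have "\<dots> = C / 2 ^ j / 2 ^ j" by (simp flip: power_mult_distrib)
    also have "\<dots> \<le> C / 2 ^ A / 2 ^ j"
      using that C(1) by (intro divide_right_mono divide_left_mono) auto
    finally show ?thesis .
  qed
  have tail_le: "cmod (tail z) \<le> 2 * (C / 2 ^ A) / 2 ^ A" if "z \<in> cball 0 (r + 1)" for z
    using r by (intro norm_entire_le_geometric[OF tail_entire _ tail_low tail_high that]) auto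
  have "poly_D (P n) (poly low) = (\<lambda>z. 0)"
    by (rule poly_D_eq_0[where m = m])
      (auto simp: entire_poly taylor_coeff_poly low_def coeff_poly_of_coeffs m_def coeff_less_valence)
  then have Ttail: "poly_D (P n) tail z = poly_D (P n) f z - c * poly_D (P n) (poly (p t)) z" for z
    unfolding tail_def by (simp add: poly_D_diff poly_D_cmult fe entire_diff entire_cmult entire_poly)
  show thesis
  proof
    show "n \<ge> 1" using S by blast
    fix z :: complex assume z: "z \<in> cball 0 R"
    have zt: "z \<in> cball 0 r" "z \<in> cball 0 (real t)"
      using z r T(3)[OF t(1)] by (auto simp: nat_le_iff ceiling_le_iff)
    have "cmod (poly_D (P n) tail z) \<le> poly_D_bound (P n) * (2 * (C / 2 ^ A) / 2 ^ A)"
      by (rule norm_poly_D_le[OF tail_entire tail_le zt(1)])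
    also have "\<dots> \<le> 2 ^ A * (2 * (C / 2 ^ A) / 2 ^ A)"
      using S C(1) by (intro mult_right_mono) auto
    also have "\<dots> = 2 * C / 2 ^ A" by simp
    also have "\<dots> \<le> 2 * C / 2 ^ t"
      using le_block_Suc[of t] C(1) by (intro divide_left_mono power_increasing) (auto simp: A_def)
    also have "\<dots> < \<epsilon> / 4" by (rule T(1)[OF t(1)])
    finally have 1: "cmod (poly_D (P n) tail z) < \<epsilon> / 4" .
    have "cmod (c * (poly_D (P n) (poly (p t)) z - poly (q t) z)) \<le> cmod c * (1 / (real t + 1))"
      unfolding norm_mult using S zt(2) by (intro mult_left_mono) auto
    also have "\<dots> < \<epsilon> / 4" using T(2)[OF t(1)] by (simp only: of_nat_Suc inverse_eq_divide add.commute)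
    finally have 2: "cmod (c * (poly_D (P n) (poly (p t)) z - poly (q t) z)) < \<epsilon> / 4" .
    have "cmod (c * (poly (q t) z - inverse c * G z)) \<le> cmod c * (\<epsilon> / 4 / cmod c)"
      unfolding norm_mult using t(3)[OF z] by (intro mult_left_mono) auto
    then have 3: "cmod (c * (poly (q t) z - inverse c * G z)) \<le> \<epsilon> / 4" using c by simp
    \<comment> \<open>The three errors come from the tail, from the block image, and from the choice
      of target; each is at most \<open>\<epsilon> / 4\<close>.\<close>
    have "poly_D (P n) f z - G z = poly_D (P n) tail z + c * (poly_D (P n) (poly (p t)) z - poly (q t) z)
        + c * (poly (q t) z - inverse c * G z)"
      using c by (simp add: Ttail algebra_simps)
    also have "cmod \<dots> < \<epsilon>"
      using 1 2 3 \<open>\<epsilon> > 0\<close>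
        norm_triangle_ineq[of "poly_D (P n) tail z" "c * (poly_D (P n) (poly (p t)) z - poly (q t) z)"]
        norm_triangle_ineq[of "poly_D (P n) tail z + c * (poly_D (P n) (poly (p t)) z - poly (q t) z)"
          "c * (poly (q t) z - inverse c * G z)"]
      by linarith
    finally show "cmod (poly_D (P n) f z - G z) < \<epsilon>" .
  qed
qed

end

section \<open>Hypercyclicity and the conclusion\<close>

lemma hypercyclic_vectors_poly_DI:
  assumes f: "f \<in> entire_functions"
    and approx: "\<And>G R \<epsilon>. G \<in> entire_functions \<Longrightarrow> \<epsilon> > 0 \<Longrightarrow>
      \<exists>n\<ge>1. \<forall>z\<in>cball 0 R. cmod (poly_D (P n) f z - G z) < \<epsilon>"
  shows "f \<in> hypercyclic_vectors entire_topology entire_topology (\<lambda>n. poly_D (P n))"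
proof -
  let ?S = "(\<lambda>n. poly_D (P n) f) ` {1..}"
  have "G \<in> entire_topology closure_of ?S" if G: "G \<in> entire_functions" for G
    unfolding in_closure_of
  proof (intro conjI allI impI)
    show "G \<in> topspace entire_topology" using G by simp
    fix U assume "G \<in> U \<and> openin entire_topology U"
    then obtain K e where K: "compact K" "e > 0"
      "{g \<in> entire_functions. \<forall>z\<in>K. dist (g z) (G z) < e} \<subseteq> U"
      unfolding openin_entire_topology by meson
    obtain R where "\<forall>z\<in>K. cmod z \<le> R"
      using compact_imp_bounded[OF K(1)] by (auto simp: bounded_iff)
    \<comment> \<open>Compact sets lie in discs about the origin, so approximation on discs reaches
      every basic neighbourhood.\<close>
    then have "K \<subseteq> cball 0 R" by auto
    moreover obtain n where "n \<ge> 1" and "\<forall>z\<in>cball 0 R. cmod (poly_D (P n) f z - G z) < e"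
      using approx[OF G K(2)] by blast
    ultimately have "\<forall>z\<in>K. dist (poly_D (P n) f z) (G z) < e"
      unfolding dist_norm by blast
    then have "poly_D (P n) f \<in> U"
      using K(3) entire_poly_D[OF f] by blast
    moreover have "poly_D (P n) f \<in> ?S" using \<open>n \<ge> 1\<close> by simp
    ultimately show "\<exists>y. y \<in> ?S \<and> y \<in> U" by blast
  qed
  then have "entire_topology closure_of ?S = topspace entire_topology"
    using closure_of_subset_topspace[of entire_topology ?S] by auto
  then show ?thesis using f by (simp add: hypercyclic_vectors_def)
qed

theorem theorem3p1:
  fixes P :: "nat \<Rightarrow> complex poly"
  assumes nonconstant: "\<And>n. n \<ge> 1 \<Longrightarrow> degree (P n) > 0"
    and valences_unbounded: "\<not> bdd_above ((\<lambda>n. valence (P n)) ` {1..})"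
    and PQR: "property_P P \<or> property_Q P \<or> property_R P"
  shows "spaceable fun_scale entire_topology
           (hypercyclic_vectors entire_topology entire_topology (\<lambda>n. poly_D (P n)))"
proof -
  obtain i :: "nat \<Rightarrow> nat" and q :: "nat \<Rightarrow> complex poly" where
    targets: "\<And>k G R \<epsilon> T. G \<in> entire_functions \<Longrightarrow> \<epsilon> > 0 \<Longrightarrow>
      \<exists>t\<ge>T. i t = k \<and> (\<forall>z\<in>cball 0 R. cmod (poly (q t) z - G z) \<le> \<epsilon>)"
    using ex_recurrent_dense_targets by blast
  obtain a \<nu> p where a0: "a 0 = 0"
    and step: "\<And>t. block_step P (poly (q t)) t (a t) (\<nu> t) (p t) (a (Suc t))"
    using ex_block_sequence[of P "\<lambda>t. poly (q t)"] ex_block_step[OF assms entire_poly] by metis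
  have a_Suc: "\<And>t. a t < a (Suc t)"
    and p: "\<And>t j. cmod (coeff (p t) j) * (2 * (real t + 1)) ^ j \<le> 1"
    using step by (auto simp: block_step_def)
  have "block_space a p i \<subseteq>
      hypercyclic_vectors entire_topology entire_topology (\<lambda>n. poly_D (P n)) \<union> {0}"
  proof
    fix f assume f: "f \<in> block_space a p i"
    show "f \<in> hypercyclic_vectors entire_topology entire_topology (\<lambda>n. poly_D (P n)) \<union> {0}"
    proof (cases "f = 0")
      case False
      have "f \<in> hypercyclic_vectors entire_topology entire_topology (\<lambda>n. poly_D (P n))"
      proof (rule hypercyclic_vectors_poly_DI)
        show "f \<in> entire_functions" using f by (simp add: block_space_def)
        show "\<exists>n\<ge>1. \<forall>z\<in>cball 0 R. cmod (poly_D (P n) f z - G z) < \<epsilon>"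
          if "G \<in> entire_functions" "\<epsilon> > 0" for G R \<epsilon>
          using block_space_approx[OF a0 a_Suc step targets f False that] by metis
      qed
      then show ?thesis by blast
    qed simp
  qed
  moreover have "\<nexists>B. finite B \<and> module.span fun_scale B = block_space a p i"
    using a0 a_Suc p by (rule block_space_not_finite_dim)
  ultimately show ?thesis
    unfolding spaceable_def
    by (intro exI[of _ "block_space a p i"] conjI closedin_block_space subspace_block_space)
qed

end
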